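(* Let $X,Y,Z$ be metric spaces, let $x_0\in X$ be a fixed base point, let $C\in[0,\infty)$, and let $p\colon Y\to Z$ be a $C$-dense bornologous map with the coarse path lifting property. Assume that either $X$ is uniformly discrete, or $Y$ is uniformly discrete and $Z$ has $C$-bounded geometry. Assume moreover that there are constants $a,b>0$ such that $d_Z(p(y),p(y'))\le a\,d_Y(y,y')+b$ for every $y,y'\in Y$. If $p$ has the $\delta$-polynomial path lifting property for some $\delta>0$, and if $X,Y,Z$ have $L^1$-compression equal to $\alpha,\beta,\gamma$ respectively, then the $L^1$-compression of the metric wreath product $X\wr_Z^C Y$ (formed with respect to $p$ and $x_0$) is bounded from below by $$\min\Big(\alpha,\ \beta,\ \frac{\gamma}{\gamma+\delta}\Big).$$
   Context: Write $\mathbb{R}^+=[0,\infty)$ and $B(x,r)=\{x' : d(x,x')\le r\}$. **$L^1$-compression.** A coarse embedding of a metric space $(X,d)$ into an $L^1$-space $L^1(\Omega,\mu)$ (for a measure space $(\Omega,\mu)$) is a map $f\colon X\to L^1(\Omega,\mu)$ for which there are non-decreasing functions $\rho_-,\rho_+\colon\mathbb{R}^+\to\mathbb{R}^+$ with $\lim_{t\to\infty}\rho_-(t)=+\infty$ such that $\rho_-(d(x,x'))\le\|f(x)-f(x')\|_1\le\rho_+(d(x,x'))$ for all $x,x'\in X$. Its compression $R(f)$ is the supremum of those $r\in[0,1]$ for which there exist $K,D>0$ with $$\tfrac1K d(x,x')^r-D\le\|f(x)-f(x')\|_1\le K\,d(x,x')+D\quad\text{for all }x,x'\in X,$$ and $R(f)=0$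 if no such $r$ exists. The $L^1$-compression of $X$ is the supremum of $R(f)$ over all coarse embeddings $f$ of $X$ into all possible $L^1$-spaces. **Conditions on spaces and maps.** - A metric space $X$ is uniformly discrete if there is $\varepsilon>0$ such that $B(x,\varepsilon)=\{x\}$ for all $x\in X$. - A metric space $X$ has $C$-bounded geometry if there is a constant $N(C)>0$ such that $|B(x,C)|\le N(C)$ for all $x\in X$. - A map $p\colon Y\to Z$ is $C$-dense if every $z\in Z$ satisfies $d_Z(p(y),z)\le C$ for some $y\in Y$. - A map $p\colon Y\to Z$ is bornologous if for every $R>0$ there is $S_R>0$ such that $d_Y(y,y')\le R$ implies $d_Z(p(y),p(y'))\le S_R$ for all $y,y'\in Y$. - A $C$-dense map $p\colon Y\to Z$ has the coarse path lifting property if there is a non-decreasing function $\theta\colon\mathbb{R}^+\to\mathbb{R}^+$ such that for all $z,z'\in Z$ and $y\in Y$ with $d_Z(p(y),z)\le C$ there is $y'\in Y$ with $d_Z(p(y'),z')\le C$ and $d_Y(y,y')\le\theta(d_Z(z,z'))$. - For $\delta>0$, $p$ has the $\delta$-polynomial path lifting property if it has the coarse path lifting property with a function $\theta$ for which there is a constant $M>0$ with $\theta(r)\le M(r^\delta+1)$ for every $r\in\mathbb{R}^+$. **Metric wreath product.** Let $p\colon Y\to Z$ be $C$-dense and $x_0\in X$. - For a finite set $I=\{z_1,\dots,z_n\}\subset Z$ of $n$ distinct points, let $\mathcal P_I$ be the set of $(y_1,\dots,y_n)\in Y^n$ for which there is a permutation $\sigma\in S_n$ with $p(y_i)\in B(z_{\sigma(i)},C)$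 for all $i$. - For $y,y'\in Y$ define $$\mathrm{path}_I(y,y')=\inf_{(y_1,\dots,y_n)\in\mathcal P_I}\Big(d_Y(y,y_1)+\sum_{i=1}^{n-1}d_Y(y_i,y_{i+1})+d_Y(y_n,y')\Big),$$ with $\mathrm{path}_\emptyset(y,y')=d_Y(y,y')$. - Let $\bigoplus_Z X$ be the set of functions $\mathbf f\colon Z\to X$ with $\mathbf f(z)=x_0$ for all but finitely many $z\in Z$. For $\mathbf f,\mathbf g\in\bigoplus_Z X$ let $\mathrm{Supp}(\mathbf f^{-1}\mathbf g)=\{z\in Z:\mathbf f(z)\ne\mathbf g(z)\}$, a finite set. - $X\wr_Z^C Y$ is the set $\bigoplus_Z X\times Y$ with the metric $$d((\mathbf f,y),(\mathbf g,y'))=\mathrm{path}_I(y,y')+\sum_{z\in Z}d_X(\mathbf f(z),\mathbf g(z)),\qquad I=\mathrm{Supp}(\mathbf f^{-1}\mathbf g).$$ *)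

theory Defs
  imports "HOL-Analysis.Analysis"
begin

section \<open>Coarse embeddings into L1-spaces and L1-compression\<close>

text \<open>
  Metric spaces are given here by a carrier \<open>M\<close> and a distance \<open>d\<close>, because the wreath product
  below is not a type. A map into \<open>L\<^sup>1(\<Omega>, \<mu>)\<close> is given by integrable representatives
  \<open>f x :: 'w \<Rightarrow> real\<close>; only the norms \<open>\<parallel>f x - f x'\<parallel>\<close> matter, and they do not depend on
  the choice of representatives.
\<close>

definition L1_norm :: "'w measure \<Rightarrow> ('w \<Rightarrow> real) \<Rightarrow> real" where
  "L1_norm \<mu> g = (\<integral>w. \<bar>g w\<bar> \<partial>\<mu>)"

definition coarse_embedding_L1 ::
  "'a set \<Rightarrow> ('a \<Rightarrow> 'a \<Rightarrow> real) \<Rightarrow> 'w measure \<Rightarrow> ('a \<Rightarrow> 'w \<Rightarrow> real) \<Rightarrow> bool" where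
  "coarse_embedding_L1 M d \<mu> f \<longleftrightarrow>
     (\<forall>x\<in>M. integrable \<mu> (f x)) \<and>
     (\<exists>\<rho>\<^sub>1 \<rho>\<^sub>2 :: real \<Rightarrow> real.
        \<rho>\<^sub>1 \<in> {0..} \<rightarrow> {0..} \<and> mono_on {0..} \<rho>\<^sub>1 \<and>
        \<rho>\<^sub>2 \<in> {0..} \<rightarrow> {0..} \<and> mono_on {0..} \<rho>\<^sub>2 \<and>
        filterlim \<rho>\<^sub>1 at_top at_top \<and>
        (\<forall>x\<in>M. \<forall>x'\<in>M.
           \<rho>\<^sub>1 (d x x') \<le> L1_norm \<mu> (\<lambda>w. f x w - f x' w) \<and>
           L1_norm \<mu> (\<lambda>w. f x w - f x' w) \<le> \<rho>\<^sub>2 (d x x')))"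

text \<open>
  \<open>0 powr 0\<close> is \<open>0\<close> and not \<open>1\<close>; the exponents \<open>r\<close> are the same under either convention,
  since \<open>D\<close> may be enlarged by \<open>1 / K\<close>.
\<close>

definition compression_exponents ::
  "'a set \<Rightarrow> ('a \<Rightarrow> 'a \<Rightarrow> real) \<Rightarrow> 'w measure \<Rightarrow> ('a \<Rightarrow> 'w \<Rightarrow> real) \<Rightarrow> real set" where
  "compression_exponents M d \<mu> f =
     {r. 0 \<le> r \<and> r \<le> 1 \<and>
         (\<exists>K D. K > 0 \<and> D > 0 \<and>
            (\<forall>x\<in>M. \<forall>x'\<in>M.
               1 / K * d x x' powr r - D \<le> L1_norm \<mu> (\<lambda>w. f x w - f x' w) \<and>
               L1_norm \<mu> (\<lambda>w. f x w - f x' w) \<le> K * d x x' + D))}"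

definition map_compression ::
  "'a set \<Rightarrow> ('a \<Rightarrow> 'a \<Rightarrow> real) \<Rightarrow> 'w measure \<Rightarrow> ('a \<Rightarrow> 'w \<Rightarrow> real) \<Rightarrow> real" where
  "map_compression M d \<mu> f =
     (if compression_exponents M d \<mu> f = {} then 0 else Sup (compression_exponents M d \<mu> f))"

text \<open>
  The supremum over all \<open>L\<^sup>1\<close>-spaces cannot range over all types \<open>'w\<close> inside a definition. It is
  taken over all measures on the one type \<open>'a \<Rightarrow> real\<close>, which loses nothing: the lemma
  \<open>map_compression_le_L1_compression\<close> below shows that it bounds the compression of every coarse
  embedding into an \<open>L\<^sup>1\<close>-space over an arbitrary type (push the measure forward along
  \<open>w \<mapsto> (\<lambda>x. f x w)\<close>). As a supremum in \<open>[0, 1]\<close>, it is \<open>0\<close> if there is no coarse embedding.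
\<close>

definition L1_compression :: "'a set \<Rightarrow> ('a \<Rightarrow> 'a \<Rightarrow> real) \<Rightarrow> real" where
  "L1_compression M d =
     (let R = {map_compression M d \<mu> f | (\<mu> :: ('a \<Rightarrow> real) measure) f.
                 coarse_embedding_L1 M d \<mu> f}
      in if R = {} then 0 else Sup R)"

lemma map_compression_bounds: "0 \<le> map_compression M d \<mu> f" "map_compression M d \<mu> f \<le> 1"
proof -
  let ?A = "compression_exponents M d \<mu> f"
  have A: "r \<in> ?A \<Longrightarrow> 0 \<le> r \<and> r \<le> 1" for r
    by (auto simp: compression_exponents_def)
  then have bdd: "bdd_above ?A" by (meson bdd_aboveI)
  show "0 \<le> map_compression M d \<mu> f"
  proof (cases "?A = {}")
    case False
    then obtain r where r: "r \<in> ?A" by blast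
    then have "0 \<le> Sup ?A" using A[OF r] cSup_upper[OF r bdd] by linarith
    then show ?thesis by (simp add: map_compression_def)
  qed (simp add: map_compression_def)
  show "map_compression M d \<mu> f \<le> 1"
    using A by (auto simp: map_compression_def intro!: cSup_least)
qed

lemma map_compression_le_L1_compression:
  fixes M :: "'a set" and \<mu> :: "'w measure"
  assumes "coarse_embedding_L1 M d \<mu> f"
  shows "map_compression M d \<mu> f \<le> L1_compression M d"
proof -
  define T where "T w = (\<lambda>x. if x \<in> M then f x w else 0)" for w
  define \<nu> :: "('a \<Rightarrow> real) measure" where "\<nu> = distr \<mu> (PiM UNIV (\<lambda>_. borel)) T"
  define g :: "'a \<Rightarrow> ('a \<Rightarrow> real) \<Rightarrow> real" where "g x u = u x" for x u
  have int: "x \<in> M \<Longrightarrow> integrable \<mu> (f x)" for x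
    using assms by (simp add: coarse_embedding_L1_def)
  have T: "T \<in> measurable \<mu> (PiM UNIV (\<lambda>_. borel))"
    unfolding T_def
  proof (rule measurable_PiM_single')
    fix x :: 'a
    show "(\<lambda>w. if x \<in> M then f x w else 0) \<in> borel_measurable \<mu>"
      using int[of x] by (cases "x \<in> M") auto
  qed auto
  have g: "g x \<in> borel_measurable (PiM UNIV (\<lambda>_. borel))" for x
    unfolding g_def by measurable
  have int': "integrable \<nu> (g x)" if "x \<in> M" for x
    unfolding \<nu>_def using int[OF that] that
    by (subst integrable_distr_eq[OF T g]) (simp add: g_def T_def)
  have norm: "L1_norm \<nu> (\<lambda>u. g x u - g x' u) = L1_norm \<mu> (\<lambda>w. f x w - f x' w)"
    if "x \<in> M" "x' \<in> M" for x x'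
  proof -
    have [measurable]: "g x \<in> borel_measurable (PiM UNIV (\<lambda>_. borel))" for x by (rule g)
    have "(\<lambda>u. \<bar>g x u - g x' u\<bar>) \<in> borel_measurable (PiM UNIV (\<lambda>_. borel))" by measurable
    then show ?thesis
      unfolding L1_norm_def \<nu>_def
      by (subst integral_distr[OF T]) (use that in \<open>simp_all add: g_def T_def\<close>)
  qed
  have ce: "coarse_embedding_L1 M d \<nu> g"
    using assms int' norm by (simp add: coarse_embedding_L1_def)
  have eq: "map_compression M d \<nu> g = map_compression M d \<mu> f"
  proof -
    have "compression_exponents M d \<nu> g = compression_exponents M d \<mu> f"
      unfolding compression_exponents_def using norm by (simp cong: ball_cong)
    then show ?thesis by (simp add: map_compression_def)
  qed
  let ?R = "{map_compression M d \<mu> f | (\<mu> :: ('a \<Rightarrow> real) measure) f. coarse_embedding_L1 M d \<mu> f}"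
  have mem: "map_compression M d \<nu> g \<in> ?R" using ce by blast
  have "bdd_above ?R" by (rule bdd_aboveI[of _ 1]) (auto simp: map_compression_bounds)
  then have "map_compression M d \<nu> g \<le> Sup ?R" using mem by (rule cSup_upper[rotated])
  then show ?thesis using mem eq by (auto simp: L1_compression_def Let_def)
qed


section \<open>Conditions on spaces and maps\<close>

lemma uniform_discrete_UNIV_iff:
  "uniform_discrete (UNIV :: 'x::metric_space set) \<longleftrightarrow> (\<exists>\<epsilon>>0. \<forall>x::'x. cball x \<epsilon> = {x})"
proof
  assume "uniform_discrete (UNIV :: 'x set)"
  then obtain e where "e > 0" and e: "\<And>x y :: 'x. dist x y < e \<Longrightarrow> x = y"
    by (auto simp: uniform_discrete_def)
  then have "cball x (e / 2) = {x}" for x :: 'x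
  proof (intro equalityI subsetI)
    fix y assume "y \<in> cball x (e / 2)"
    then have "dist x y < e" using \<open>e > 0\<close> by simp
    then show "y \<in> {x}" using e by blast
  qed (use \<open>e > 0\<close> in simp)
  then show "\<exists>\<epsilon>>0. \<forall>x::'x. cball x \<epsilon> = {x}"
    using \<open>e > 0\<close> by (intro exI[of _ "e / 2"]) simp
next
  assume "\<exists>\<epsilon>>0. \<forall>x::'x. cball x \<epsilon> = {x}"
  then obtain e where "e > 0" and e: "\<And>x :: 'x. cball x e = {x}" by blast
  have "x = y" if "dist x y < e" for x y :: 'x
    using e[of x] that by (metis less_imp_le mem_cball singletonD)
  then show "uniform_discrete (UNIV :: 'x set)"
    using \<open>e > 0\<close> by (auto simp: uniform_discrete_def)
qed

definition bounded_geometry :: "real \<Rightarrow> 'z::metric_space itself \<Rightarrow> bool" where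
  "bounded_geometry C (_ :: 'z itself) \<longleftrightarrow>
     (\<exists>N::nat. N > 0 \<and> (\<forall>z::'z. finite (cball z C) \<and> card (cball z C) \<le> N))"

definition C_dense :: "real \<Rightarrow> ('y \<Rightarrow> 'z::metric_space) \<Rightarrow> bool" where
  "C_dense C p \<longleftrightarrow> (\<forall>z. \<exists>y. dist (p y) z \<le> C)"

definition bornologous :: "('y::metric_space \<Rightarrow> 'z::metric_space) \<Rightarrow> bool" where
  "bornologous p \<longleftrightarrow>
     (\<forall>R>0. \<exists>S>0. \<forall>y y'. dist y y' \<le> R \<longrightarrow> dist (p y) (p y') \<le> S)"

definition lifts_paths_with ::
  "real \<Rightarrow> ('y::metric_space \<Rightarrow> 'z::metric_space) \<Rightarrow> (real \<Rightarrow> real) \<Rightarrow> bool" where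
  "lifts_paths_with C p \<theta> \<longleftrightarrow>
     \<theta> \<in> {0..} \<rightarrow> {0..} \<and> mono_on {0..} \<theta> \<and>
     (\<forall>z z' y. dist (p y) z \<le> C \<longrightarrow>
        (\<exists>y'. dist (p y') z' \<le> C \<and> dist y y' \<le> \<theta> (dist z z')))"

definition coarse_path_lifting :: "real \<Rightarrow> ('y::metric_space \<Rightarrow> 'z::metric_space) \<Rightarrow> bool" where
  "coarse_path_lifting C p \<longleftrightarrow> (\<exists>\<theta>. lifts_paths_with C p \<theta>)"

definition polynomial_path_lifting ::
  "real \<Rightarrow> real \<Rightarrow> ('y::metric_space \<Rightarrow> 'z::metric_space) \<Rightarrow> bool" where
  "polynomial_path_lifting \<delta> C p \<longleftrightarrow>
     (\<exists>\<theta>. lifts_paths_with C p \<theta> \<and> (\<exists>M>0. \<forall>r\<ge>0. \<theta> r \<le> M * (r powr \<delta> + 1)))"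


section \<open>The metric wreath product\<close>

text \<open>
  The set \<open>P\<^sub>I\<close>: the list \<open>zs\<close> is an enumeration \<open>z\<^bsub>\<sigma>(1)\<^esub>, \<dots>, z\<^bsub>\<sigma>(n)\<^esub>\<close> of \<open>I\<close> without repetitions.
\<close>

definition tours :: "real \<Rightarrow> ('y \<Rightarrow> 'z::metric_space) \<Rightarrow> 'z set \<Rightarrow> 'y list set" where
  "tours C p I =
     {ys. \<exists>zs. distinct zs \<and> set zs = I \<and> list_all2 (\<lambda>y z. p y \<in> cball z C) ys zs}"

fun tour_length :: "'y::metric_space \<Rightarrow> 'y list \<Rightarrow> 'y \<Rightarrow> real" where
  "tour_length y [] y' = dist y y'"
| "tour_length y (v # vs) y' = dist y v + tour_length v vs y'"

definition path_dist ::
  "real \<Rightarrow> ('y::metric_space \<Rightarrow> 'z::metric_space) \<Rightarrow> 'z set \<Rightarrow> 'y \<Rightarrow> 'y \<Rightarrow> real" where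
  "path_dist C p I y y' = (INF ys \<in> tours C p I. tour_length y ys y')"

definition wreath_carrier :: "'x \<Rightarrow> (('z \<Rightarrow> 'x) \<times> 'y) set" where
  "wreath_carrier x0 = {f. finite {z. f z \<noteq> x0}} \<times> UNIV"

text \<open>
  The sum over all \<open>z\<close> is written as a sum over the finite set of \<open>z\<close> with \<open>f z \<noteq> g z\<close>; all
  other terms vanish.
\<close>

definition wreath_dist ::
  "real \<Rightarrow> ('y::metric_space \<Rightarrow> 'z::metric_space) \<Rightarrow>
     ('z \<Rightarrow> 'x::metric_space) \<times> 'y \<Rightarrow> ('z \<Rightarrow> 'x) \<times> 'y \<Rightarrow> real" where
  "wreath_dist C p u v =
     (case (u, v) of ((f, y), (g, y')) \<Rightarrow>
        let I = {z. f z \<noteq> g z} in path_dist C p I y y' + (\<Sum>z\<in>I. dist (f z) (g z)))"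

lemma path_dist_empty: "path_dist C p {} y y' = dist y y'"
proof -
  have "tours C p {} = {[]}" by (auto simp: tours_def)
  then show ?thesis by (simp add: path_dist_def)
qed

lemma tours_nonempty:
  assumes "C_dense C p" "finite I"
  shows "tours C p I \<noteq> {}"
proof -
  obtain zs where zs: "set zs = I" "distinct zs"
    using finite_distinct_list[OF assms(2)] by blast
  obtain s where s: "\<And>z. dist (p (s z)) z \<le> C"
    using assms(1) unfolding C_dense_def by metis
  have "list_all2 (\<lambda>y z. p y \<in> cball z C) (map s zs) zs"
    using s by (simp add: list_all2_map1 list.rel_refl dist_commute)
  then have "map s zs \<in> tours C p I" using zs unfolding tours_def by blast
  then show ?thesis by blast
qed

lemma tour_length_ge: "dist y y' \<le> tour_length y ys y'"
proof (induction ys arbitrary: y)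
  case (Cons v vs)
  have "dist y y' \<le> dist y v + dist v y'" by (rule dist_triangle)
  also have "dist v y' \<le> tour_length v vs y'" by (rule Cons.IH)
  finally show ?case by simp
qed simp

lemma tour_length_append_single:
  "tour_length y (vs @ [v]) y' = tour_length y vs v + dist v y'"
  by (induction vs arbitrary: y) auto

lemma tour_length_rev: "tour_length y' (rev ys) y = tour_length y ys y'"
  by (induction ys arbitrary: y) (auto simp: tour_length_append_single dist_commute)

lemma tour_length_append_le:
  "tour_length y (us @ vs) y'' \<le> tour_length y us y' + tour_length y' vs y''"
proof (induction us arbitrary: y)
  case Nil
  show ?case
  proof (cases vs)
    case Nil
    then show ?thesis by (simp add: dist_triangle)
  next
    case (Cons w ws)
    then show ?thesis by (simp add: dist_triangle)
  qed
qed (simp add: add.assoc)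

lemma tour_length_triangle: "tour_length y vs y' \<le> dist y v + tour_length v vs y'"
  by (cases vs) (auto simp: dist_triangle add.assoc[symmetric])

lemma subtour:
  assumes "list_all2 P ys zs" "J \<subseteq> set zs"
  shows "\<exists>ys' zs'. distinct zs' \<and> set zs' = J \<and> list_all2 P ys' zs' \<and>
           tour_length y ys' y' \<le> tour_length y ys y'"
  using assms
proof (induction ys zs arbitrary: J y rule: list_all2_induct)
  case Nil
  then show ?case by (intro exI[of _ "[]"]) simp
next
  case (Cons v ys z zs)
  have "J - {z} \<subseteq> set zs" using Cons.prems by auto
  from Cons.IH[OF this] obtain us ws where *: "distinct ws" "set ws = J - {z}"
    "list_all2 P us ws" "tour_length v us y' \<le> tour_length v ys y'" by blast
  show ?case
  proof (cases "z \<in> J")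
    case True
    then show ?thesis using * Cons.hyps
      by (intro exI[of _ "v # us"] exI[of _ "z # ws"]) auto
  next
    case False
    then show ?thesis using * tour_length_triangle[of y us y' v]
      by (intro exI[of _ us] exI[of _ ws]) auto
  qed
qed

lemma path_dist_le: "ys \<in> tours C p I \<Longrightarrow> path_dist C p I y y' \<le> tour_length y ys y'"
  unfolding path_dist_def
  by (intro cINF_lower bdd_belowI2[where m = "dist y y'"] tour_length_ge)

lemma path_dist_ge:
  assumes "C_dense C p" "finite I"
  shows "dist y y' \<le> path_dist C p I y y'"
  unfolding path_dist_def by (intro cINF_greatest tours_nonempty assms tour_length_ge)

lemma path_dist_commute: "path_dist C p I y y' = path_dist C p I y' y"
proof -
  have *: "rev ys \<in> tours C p I" if "ys \<in> tours C p I" for ys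
  proof -
    from that obtain zs where "distinct zs" "set zs = I"
      "list_all2 (\<lambda>y z. p y \<in> cball z C) ys zs" unfolding tours_def by blast
    then show ?thesis unfolding tours_def
      by (intro CollectI exI[of _ "rev zs"]) auto
  qed
  have "(\<lambda>ys. tour_length y ys y') ` tours C p I = (\<lambda>ys. tour_length y' ys y) ` tours C p I"
    (is "?A = ?B")
  proof (intro equalityI subsetI)
    fix t assume "t \<in> ?A"
    then obtain ys where "ys \<in> tours C p I" "t = tour_length y ys y'" by blast
    then show "t \<in> ?B" using *[of ys] tour_length_rev[of y' ys y] by (metis imageI)
  next
    fix t assume "t \<in> ?B"
    then obtain ys where "ys \<in> tours C p I" "t = tour_length y' ys y" by blast
    then show "t \<in> ?A" using *[of ys] tour_length_rev[of y ys y'] by (metis imageI)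
  qed
  then show ?thesis by (simp add: path_dist_def)
qed

lemma path_dist_triangle:
  assumes "C_dense C p" "finite I" "finite J" "K \<subseteq> I \<union> J"
  shows "path_dist C p K y y'' \<le> path_dist C p I y y' + path_dist C p J y' y''"
proof -
  have *: "path_dist C p K y y'' \<le> tour_length y us y' + tour_length y' vs y''"
    if us: "us \<in> tours C p I" and vs: "vs \<in> tours C p J" for us vs
  proof -
    let ?P = "\<lambda>y z. p y \<in> cball z C"
    obtain zs ws where "set zs = I" "list_all2 ?P us zs" "set ws = J" "list_all2 ?P vs ws"
      using us vs unfolding tours_def by blast
    then have "list_all2 ?P (us @ vs) (zs @ ws)" "K \<subseteq> set (zs @ ws)"
      using assms(4) by (auto intro: list_all2_appendI)
    from subtour[OF this] obtain ts where "ts \<in> tours C p K"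
      "tour_length y ts y'' \<le> tour_length y (us @ vs) y''"
      unfolding tours_def by blast
    then show ?thesis
      using path_dist_le[of ts C p K y y''] tour_length_append_le[of y us vs y'' y'] by linarith
  qed
  have "path_dist C p K y y'' - tour_length y us y' \<le> path_dist C p J y' y''" if "us \<in> tours C p I" for us
    unfolding path_dist_def[of C p J]
    by (intro cINF_greatest tours_nonempty assms) (use *[OF that] in force)
  then have "path_dist C p K y y'' - path_dist C p J y' y'' \<le> path_dist C p I y y'"
    unfolding path_dist_def[of C p I] by (intro cINF_greatest tours_nonempty assms) force
  then show ?thesis by simp
qed

lemma finite_support:
  assumes "finite {z. f z \<noteq> c}" "finite {z. g z \<noteq> c}"
  shows "finite {z. f z \<noteq> g z}"
  by (rule finite_subset[OF _ finite_UnI[OF assms]]) auto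

lemma Metric_space_wreath:
  fixes p :: "'y::metric_space \<Rightarrow> 'z::metric_space" and x0 :: "'x::metric_space"
  assumes dense: "C_dense C p"
  shows "\<exists>d. Metric_space (wreath_carrier x0) d \<and>
           (\<forall>u \<in> wreath_carrier x0. \<forall>v \<in> wreath_carrier x0. d u v = wreath_dist C p u v)"
proof -
  let ?W = "wreath_carrier x0 :: (('z \<Rightarrow> 'x) \<times> 'y) set" and ?d = "wreath_dist C p"
  have nonneg: "0 \<le> ?d u v" if "u \<in> ?W" "v \<in> ?W" for u v :: "('z \<Rightarrow> 'x) \<times> 'y"
  proof -
    obtain f y g y' where uv: "u = (f, y)" "v = (g, y')" by fastforce
    then have fin: "finite {z. f z \<noteq> g z}" using that
      by (auto simp: wreath_carrier_def intro: finite_support)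
    have "0 \<le> path_dist C p {z. f z \<noteq> g z} y y'"
      using path_dist_ge[OF dense fin, of y y'] zero_le_dist[of y y'] by linarith
    then show ?thesis by (simp add: uv wreath_dist_def Let_def sum_nonneg)
  qed
  have commute: "?d u v = ?d v u" for u v :: "('z \<Rightarrow> 'x) \<times> 'y"
  proof -
    obtain f y g y' where uv: "u = (f, y)" "v = (g, y')" by fastforce
    have "{z. g z \<noteq> f z} = {z. f z \<noteq> g z}" by auto
    then show ?thesis
      by (simp add: uv wreath_dist_def Let_def path_dist_commute[of C p _ y y'] dist_commute)
  qed
  have zero: "?d u v = 0 \<longleftrightarrow> u = v" if "u \<in> ?W" "v \<in> ?W" for u v :: "('z \<Rightarrow> 'x) \<times> 'y"
  proof -
    obtain f y g y' where uv: "u = (f, y)" "v = (g, y')" by fastforce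
    let ?I = "{z. f z \<noteq> g z}"
    have fin: "finite ?I" using that uv
      by (auto simp: wreath_carrier_def intro: finite_support)
    have ge: "dist y y' \<le> path_dist C p ?I y y'" by (rule path_dist_ge[OF dense fin])
    have s: "0 \<le> (\<Sum>z\<in>?I. dist (f z) (g z))" by (simp add: sum_nonneg)
    show ?thesis
    proof
      assume "?d u v = 0"
      then have eq: "path_dist C p ?I y y' + (\<Sum>z\<in>?I. dist (f z) (g z)) = 0"
        by (simp add: uv wreath_dist_def Let_def)
      have "dist y y' = 0" "(\<Sum>z\<in>?I. dist (f z) (g z)) = 0"
        using eq ge s zero_le_dist[of y y'] by linarith+
      then have "y = y'" "\<forall>z\<in>?I. dist (f z) (g z) = 0"
        using sum_nonneg_eq_0_iff[OF fin, of "\<lambda>z. dist (f z) (g z)"] by simp_all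
      then show "u = v" unfolding uv by auto
    next
      assume "u = v"
      then show "?d u v = 0" by (simp add: uv wreath_dist_def Let_def path_dist_empty)
    qed
  qed
  have triangle: "?d u w \<le> ?d u v + ?d v w" if "u \<in> ?W" "v \<in> ?W" "w \<in> ?W"
    for u v w :: "('z \<Rightarrow> 'x) \<times> 'y"
  proof -
    obtain f y g y' h y'' where uv: "u = (f, y)" "v = (g, y')" "w = (h, y'')" by (metis surj_pair)
    let ?I = "{z. f z \<noteq> g z}" and ?J = "{z. g z \<noteq> h z}" and ?K = "{z. f z \<noteq> h z}"
    have fin: "finite ?I" "finite ?J" using that uv
      by (auto simp: wreath_carrier_def intro: finite_support)
    have sub: "?K \<subseteq> ?I \<union> ?J" by auto
    have "(\<Sum>z\<in>?K. dist (f z) (h z)) \<le> (\<Sum>z\<in>?I \<union> ?J. dist (f z) (h z))"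
      using fin sub by (intro sum_mono2) auto
    also have "\<dots> \<le> (\<Sum>z\<in>?I \<union> ?J. dist (f z) (g z)) + (\<Sum>z\<in>?I \<union> ?J. dist (g z) (h z))"
      unfolding sum.distrib[symmetric] by (intro sum_mono dist_triangle)
    also have "(\<Sum>z\<in>?I \<union> ?J. dist (f z) (g z)) = (\<Sum>z\<in>?I. dist (f z) (g z))"
      using fin by (intro sum.mono_neutral_right) auto
    also have "(\<Sum>z\<in>?I \<union> ?J. dist (g z) (h z)) = (\<Sum>z\<in>?J. dist (g z) (h z))"
      using fin by (intro sum.mono_neutral_right) auto
    finally show ?thesis
      using path_dist_triangle[OF dense fin sub, of y y'' y']
      by (simp add: uv wreath_dist_def Let_def)
  qed
  define d where "d u v = (if u \<in> ?W \<and> v \<in> ?W then ?d u v else 0)" for u v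
  have "Metric_space ?W d"
    by unfold_locales (use nonneg commute zero triangle in \<open>auto simp: d_def\<close>)
  then show ?thesis by (intro exI[of _ d]) (simp add: d_def)
qed

end

theory Submission
  imports Defs
begin

text \<open>
  All estimates concern only the distances \<open>\<parallel>f x - f x'\<parallel>\<close>, so the proof works with the functions
  \<open>D x x'\<close> of this form, the \<open>L\<^sup>1\<close>-kernels. They can be pulled back along maps, multiplied by
  nonnegative constants and added up, even over an arbitrary index set as long as each \<open>D x x'\<close> has
  finitely many nonzero terms. Given kernels \<open>D\<^sub>X, D\<^sub>Y, D\<^sub>Z\<close> that nearly attain the compressions of
  \<open>X, Y, Z\<close>, the wreath product gets the kernel that sends a pair \<open>(f, y), (g, y')\<close> to

  \<open>D\<^sub>Y(y, y') + D\<^sub>Z(p y, p y') + W + (\<Sum>z. D\<^sub>X(f z, g z) + c * [f z \<noteq> g z])\<close>.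

  Here \<open>W\<close> comes from walls. The superlevel sets \<open>{z. h z w > t}\<close> of a map \<open>h\<close> from \<open>Z\<close> to \<open>L\<^sup>1(\<mu>)\<close>
  are a family of cuts of \<open>Z\<close>, indexed by the pairs \<open>(w, t)\<close>, and the cuts that separate \<open>u\<close> from \<open>v\<close>
  have measure \<open>\<parallel>h u - h v\<parallel>\<close>. A point \<open>(f, y)\<close> assigns to each cut the restriction of \<open>f\<close> to the side
  that does not contain \<open>p y\<close>, and \<open>W\<close> is twice the measure of the cuts to which \<open>(f, y)\<close> and
  \<open>(g, y')\<close> assign different restrictions (\<open>wreath_wall_kernel\<close>). Such a cut is crossed by every walk
  from \<open>p y\<close> to \<open>p y'\<close> through all points where \<open>f\<close> and \<open>g\<close> differ, so \<open>W\<close> is bounded linearly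
  by the length of any tour and the number of these points. Conversely, a cut that separates such a
  point from both \<open>p y\<close> and \<open>p y'\<close> is counted, so a point far from \<open>p y\<close> makes \<open>W\<close> or the summand
  \<open>D\<^sub>Z(p y, p y')\<close> large.

  For the lower bound, let the kernel have the value \<open>s\<close>. Up to constants, there are at most \<open>s\<close> points
  where \<open>f\<close> and \<open>g\<close> differ, because of the discrete term, and they lie within \<open>s powr (1 / \<gamma>)\<close> of
  \<open>p y\<close>. Lifting paths, one visits each of them from \<open>y\<close> and returns at cost \<open>s powr (\<delta> / \<gamma>)\<close>, so a
  tour of length \<open>s powr (1 + \<delta> / \<gamma>) + d(y, y')\<close> exists; this is where \<open>\<gamma> / (\<gamma> + \<delta>)\<close> comes from
  (\<open>path_dist_le_star\<close>, \<open>wreath_growth\<close>). The upper bound is linear because the number of points where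
  \<open>f\<close> and \<open>g\<close> differ is at most linear in the distance of \<open>(f, y)\<close> and \<open>(g, y')\<close>
  (\<open>card_support_le_wreath_dist\<close>): either each of them contributes a definite amount to the sum over
  \<open>Z\<close>, or a tour can serve only boundedly many of them without moving on by a definite distance.
\<close>

section \<open>Pullbacks of \<open>L\<^sup>1\<close>-distances\<close>

definition L1_kernel :: "'a set \<Rightarrow> ('a \<Rightarrow> 'a \<Rightarrow> real) \<Rightarrow> bool" where
  "L1_kernel M D \<longleftrightarrow>
     (\<exists>(\<mu> :: ('a \<Rightarrow> real) measure) f. (\<forall>x\<in>M. integrable \<mu> (f x)) \<and>
        (\<forall>x\<in>M. \<forall>x'\<in>M. D x x' = L1_norm \<mu> (\<lambda>w. f x w - f x' w)))"

text \<open>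
  The definition asks for a measure on the type \<open>'a \<Rightarrow> real\<close>, so that kernels from different sources
  live on the same type and can be added. Pushing \<open>\<mu>\<close> forward along \<open>w \<mapsto> (\<lambda>x. f x w)\<close> shows that a
  measure on any other type will do.
\<close>
lemma L1_kernelI:
  fixes \<mu> :: "'w measure"
  assumes int: "\<And>x. x \<in> M \<Longrightarrow> integrable \<mu> (f x)"
    and D: "\<And>x x'. x \<in> M \<Longrightarrow> x' \<in> M \<Longrightarrow> D x x' = L1_norm \<mu> (\<lambda>w. f x w - f x' w)"
  shows "L1_kernel M D"
proof -
  define T where "T w = (\<lambda>x. if x \<in> M then f x w else 0)" for w
  define P :: "('a \<Rightarrow> real) measure" where "P = PiM UNIV (\<lambda>_. borel)"
  have T: "T \<in> measurable \<mu> P"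
    unfolding T_def P_def
  proof (rule measurable_PiM_single')
    fix x :: 'a
    show "(\<lambda>w. if x \<in> M then f x w else 0) \<in> borel_measurable \<mu>"
      using int[of x] by (cases "x \<in> M") auto
  qed auto
  have [measurable]: "(\<lambda>u. u x) \<in> borel_measurable P" for x
    unfolding P_def by measurable
  have "integrable (distr \<mu> P T) (\<lambda>u. u x)" if "x \<in> M" for x
    using int[OF that] that by (subst integrable_distr_eq[OF T]) (simp_all add: T_def)
  moreover have "D x x' = L1_norm (distr \<mu> P T) (\<lambda>u. u x - u x')" if "x \<in> M" "x' \<in> M" for x x'
    unfolding D[OF that] L1_norm_def using that
    by (subst integral_distr[OF T]) (simp_all add: T_def)
  ultimately show ?thesis
    unfolding L1_kernel_def by (intro exI[of _ "distr \<mu> P T"] exI[of _ "\<lambda>x u. u x"]) blast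
qed

lemma L1_kernelE:
  fixes M :: "'a set"
  assumes "L1_kernel M D"
  obtains \<mu> :: "('a \<Rightarrow> real) measure" and f where
    "\<And>x. x \<in> M \<Longrightarrow> integrable \<mu> (f x)"
    "\<And>x x'. x \<in> M \<Longrightarrow> x' \<in> M \<Longrightarrow> D x x' = L1_norm \<mu> (\<lambda>w. f x w - f x' w)"
  using assms unfolding L1_kernel_def by blast

lemma L1_kernel_cong:
  assumes "\<And>x x'. x \<in> M \<Longrightarrow> x' \<in> M \<Longrightarrow> D x x' = E x x'"
  shows "L1_kernel M D \<longleftrightarrow> L1_kernel M E"
  unfolding L1_kernel_def using assms by (simp cong: ball_cong)

lemma L1_kernel_nonneg: "L1_kernel M D \<Longrightarrow> x \<in> M \<Longrightarrow> x' \<in> M \<Longrightarrow> 0 \<le> D x x'"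
  by (auto elim!: L1_kernelE simp: L1_norm_def)

lemma L1_kernel_refl: "L1_kernel M D \<Longrightarrow> x \<in> M \<Longrightarrow> D x x = 0"
  by (auto elim!: L1_kernelE simp: L1_norm_def)

lemma L1_kernel_comp:
  assumes "L1_kernel M D" "\<And>x. x \<in> N \<Longrightarrow> \<phi> x \<in> M"
  shows "L1_kernel N (\<lambda>x x'. D (\<phi> x) (\<phi> x'))"
  using assms(1)
proof (rule L1_kernelE)
  fix \<mu> :: "('a \<Rightarrow> real) measure" and f
  assume "\<And>x. x \<in> M \<Longrightarrow> integrable \<mu> (f x)"
    "\<And>x x'. x \<in> M \<Longrightarrow> x' \<in> M \<Longrightarrow> D x x' = L1_norm \<mu> (\<lambda>w. f x w - f x' w)"
  then show ?thesis
    using assms(2) by (intro L1_kernelI[of N \<mu> "\<lambda>x. f (\<phi> x)"]) auto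
qed

lemma L1_kernel_scale:
  assumes "L1_kernel M D" "0 \<le> c"
  shows "L1_kernel M (\<lambda>x x'. c * D x x')"
  using assms(1)
proof (rule L1_kernelE)
  fix \<mu> :: "('a \<Rightarrow> real) measure" and f
  assume f: "\<And>x. x \<in> M \<Longrightarrow> integrable \<mu> (f x)"
    "\<And>x x'. x \<in> M \<Longrightarrow> x' \<in> M \<Longrightarrow> D x x' = L1_norm \<mu> (\<lambda>w. f x w - f x' w)"
  show ?thesis
    by (rule L1_kernelI[of M \<mu> "\<lambda>x w. c * f x w"])
      (use f assms(2) in \<open>auto simp: L1_norm_def right_diff_distrib[symmetric] abs_mult\<close>)
qed

text \<open>
  The disjoint union of measure spaces, with the largest \<open>\<sigma>\<close>-algebra that makes all inclusions
  measurable. It makes sense for uncountably many summands that are not \<open>\<sigma>\<close>-finite, unlike a product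
  with a counting measure.
\<close>
definition direct_sum :: "('i \<Rightarrow> 'w measure) \<Rightarrow> ('i \<times> 'w) measure" where
  "direct_sum \<mu> =
     measure_of (SIGMA i:UNIV. space (\<mu> i))
       {A. A \<subseteq> (SIGMA i:UNIV. space (\<mu> i)) \<and> (\<forall>i. Pair i -` A \<in> sets (\<mu> i))}
       (\<lambda>A. \<integral>\<^sup>+i. emeasure (\<mu> i) (Pair i -` A) \<partial>count_space UNIV)"

lemma
  shows space_direct_sum: "space (direct_sum \<mu>) = (SIGMA i:UNIV. space (\<mu> i))" (is ?space)
    and sets_direct_sum: "sets (direct_sum \<mu>) =
      {A. A \<subseteq> (SIGMA i:UNIV. space (\<mu> i)) \<and> (\<forall>i. Pair i -` A \<in> sets (\<mu> i))}" (is ?sets)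
    and emeasure_direct_sum: "A \<in> sets (direct_sum \<mu>) \<Longrightarrow>
      emeasure (direct_sum \<mu>) A = (\<integral>\<^sup>+i. emeasure (\<mu> i) (Pair i -` A) \<partial>count_space UNIV)"
proof -
  let ?\<Omega> = "SIGMA i:UNIV. space (\<mu> i)"
  let ?S = "{A. A \<subseteq> ?\<Omega> \<and> (\<forall>i. Pair i -` A \<in> sets (\<mu> i))}"
  have compl: "Pair i -` (?\<Omega> - A) = space (\<mu> i) - Pair i -` A" for i A by auto
  have S: "sigma_algebra ?\<Omega> ?S"
    unfolding sigma_algebra_iff2 by (auto simp: compl vimage_UN)
  show ?space unfolding direct_sum_def by (rule space_measure_of) auto
  show sets: ?sets
    unfolding direct_sum_def
    by (rule sigma_algebra.sets_measure_of_eq[OF S])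
  assume "A \<in> sets (direct_sum \<mu>)"
  then have A: "A \<in> ?S" by (simp only: sets)
  show "emeasure (direct_sum \<mu>) A = (\<integral>\<^sup>+i. emeasure (\<mu> i) (Pair i -` A) \<partial>count_space UNIV)"
    unfolding direct_sum_def
  proof (rule emeasure_measure_of_sigma[OF S _ _ A])
    show "positive ?S (\<lambda>A. \<integral>\<^sup>+i. emeasure (\<mu> i) (Pair i -` A) \<partial>count_space UNIV)"
      by (simp add: positive_def)
    show "countably_additive ?S (\<lambda>A. \<integral>\<^sup>+i. emeasure (\<mu> i) (Pair i -` A) \<partial>count_space UNIV)"
    proof (rule countably_additiveI)
      fix B :: "nat \<Rightarrow> ('a \<times> 'b) set"
      assume B: "range B \<subseteq> ?S" "disjoint_family B"
      have "(\<Sum>n. emeasure (\<mu> i) (Pair i -` B n)) = emeasure (\<mu> i) (Pair i -` (\<Union>n. B n))" for i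
        unfolding vimage_UN
      proof (rule suminf_emeasure)
        show "range (\<lambda>n. Pair i -` B n) \<subseteq> sets (\<mu> i)" using B(1) by auto
        show "disjoint_family (\<lambda>n. Pair i -` B n)" using B(2) unfolding disjoint_family_on_def by blast
      qed
      then show "(\<Sum>n. \<integral>\<^sup>+i. emeasure (\<mu> i) (Pair i -` B n) \<partial>count_space UNIV) =
          (\<integral>\<^sup>+i. emeasure (\<mu> i) (Pair i -` (\<Union>n. B n)) \<partial>count_space UNIV)"
        by (subst nn_integral_suminf[symmetric]) auto
    qed
  qed
qed

lemma measurable_Pair_direct_sum [measurable]: "Pair i \<in> measurable (\<mu> i) (direct_sum \<mu>)"
proof (rule measurableI)
  fix A assume "A \<in> sets (direct_sum \<mu>)"
  then have "A \<subseteq> (SIGMA i:UNIV. space (\<mu> i))" "Pair i -` A \<in> sets (\<mu> i)"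
    unfolding sets_direct_sum by auto
  moreover from this have "Pair i -` A \<inter> space (\<mu> i) = Pair i -` A" by auto
  ultimately show "Pair i -` A \<inter> space (\<mu> i) \<in> sets (\<mu> i)" by simp
qed (simp add: space_direct_sum)

lemma measurable_direct_sum:
  assumes "\<And>i. (\<lambda>w. f (i, w)) \<in> measurable (\<mu> i) N"
  shows "f \<in> measurable (direct_sum \<mu>) N"
proof (rule measurableI)
  show "x \<in> space (direct_sum \<mu>) \<Longrightarrow> f x \<in> space N" for x
    using measurable_space[OF assms] by (auto simp: space_direct_sum)
  fix A assume "A \<in> sets N"
  then have "(\<lambda>w. f (i, w)) -` A \<inter> space (\<mu> i) \<in> sets (\<mu> i)" for i
    using assms measurable_sets by blast
  moreover have "Pair i -` (f -` A \<inter> space (direct_sum \<mu>)) = (\<lambda>w. f (i, w)) -` A \<inter> space (\<mu> i)" for i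
    by (auto simp: space_direct_sum)
  ultimately show "f -` A \<inter> space (direct_sum \<mu>) \<in> sets (direct_sum \<mu>)"
    unfolding sets_direct_sum by (auto simp: space_direct_sum)
qed

lemma nn_integral_direct_sum:
  assumes "f \<in> borel_measurable (direct_sum \<mu>)"
  shows "(\<integral>\<^sup>+x. f x \<partial>direct_sum \<mu>) = (\<integral>\<^sup>+i. (\<integral>\<^sup>+w. f (i, w) \<partial>\<mu> i) \<partial>count_space UNIV)"
  using assms
proof induction
  case (cong f g)
  have "(\<integral>\<^sup>+w. f (i, w) \<partial>\<mu> i) = (\<integral>\<^sup>+w. g (i, w) \<partial>\<mu> i)" for i
    by (rule nn_integral_cong) (simp add: cong space_direct_sum)
  moreover have "(\<integral>\<^sup>+x. f x \<partial>direct_sum \<mu>) = (\<integral>\<^sup>+x. g x \<partial>direct_sum \<mu>)"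
    by (rule nn_integral_cong) (simp add: cong)
  ultimately show ?case using cong.IH by simp
next
  case (set A)
  then have "Pair i -` A \<in> sets (\<mu> i)" for i by (simp add: sets_direct_sum)
  then have "emeasure (\<mu> i) (Pair i -` A) = (\<integral>\<^sup>+w. indicator (Pair i -` A) w \<partial>\<mu> i)" for i
    by simp
  then have "emeasure (\<mu> i) (Pair i -` A) = (\<integral>\<^sup>+w. indicator A (i, w) \<partial>\<mu> i)" for i
    by (simp only: indicator_vimage)
  then show ?case using set by (simp add: emeasure_direct_sum)
next
  case (mult f c)
  have "(\<lambda>w. f (i, w)) \<in> borel_measurable (\<mu> i)" for i
    using measurable_compose[OF measurable_Pair_direct_sum mult.hyps(2)] .
  then show ?case using mult.hyps(2) by (simp add: nn_integral_cmult mult.IH)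
next
  case (add f g)
  note m = measurable_compose[OF measurable_Pair_direct_sum add.hyps(1)]
    measurable_compose[OF measurable_Pair_direct_sum add.hyps(3)]
  show ?case using add.hyps(1,3) m by (simp add: nn_integral_add add.IH)
next
  case (seq F)
  have m: "(\<lambda>w. F n (i, w)) \<in> borel_measurable (\<mu> i)" for i n
    using measurable_compose[OF measurable_Pair_direct_sum seq.hyps(1)] .
  have inc: "incseq (\<lambda>n w. F n (i, w))" for i
    using seq.hyps by (auto simp: incseq_def le_fun_def)
  have "(\<integral>\<^sup>+x. (SUP n. F n x) \<partial>direct_sum \<mu>) = (SUP n. \<integral>\<^sup>+x. F n x \<partial>direct_sum \<mu>)"
    using seq.hyps by (intro nn_integral_monotone_convergence_SUP) auto
  also have "\<dots> = (SUP n. \<integral>\<^sup>+i. (\<integral>\<^sup>+w. F n (i, w) \<partial>\<mu> i) \<partial>count_space UNIV)"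
    using seq.IH by simp
  also have "\<dots> = (\<integral>\<^sup>+i. (SUP n. \<integral>\<^sup>+w. F n (i, w) \<partial>\<mu> i) \<partial>count_space UNIV)"
    using inc by (intro nn_integral_monotone_convergence_SUP[symmetric])
      (auto simp: incseq_def le_fun_def intro!: nn_integral_mono)
  also have "\<dots> = (\<integral>\<^sup>+i. (\<integral>\<^sup>+w. (SUP n. F n (i, w)) \<partial>\<mu> i) \<partial>count_space UNIV)"
    by (intro nn_integral_cong nn_integral_monotone_convergence_SUP[symmetric] inc m)
  finally show ?case by (simp add: image_comp)
qed

text \<open>
  The maps are normalised to vanish at a base point: then the image of \<open>x\<close> in the direct sum has norm
  \<open>\<Sum>i. D i x c\<close>, which is finite.
\<close>
lemma L1_kernel_sum:
  fixes D :: "'i \<Rightarrow> 'a \<Rightarrow> 'a \<Rightarrow> real"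
  assumes ker: "\<And>i. L1_kernel M (D i)"
    and fin: "\<And>x x'. x \<in> M \<Longrightarrow> x' \<in> M \<Longrightarrow> finite {i. D i x x' \<noteq> 0}"
  shows "L1_kernel M (\<lambda>x x'. \<Sum>i | D i x x' \<noteq> 0. D i x x')"
proof (cases "M = {}")
  case True
  then show ?thesis by (auto simp: L1_kernel_def)
next
  case False
  then obtain c where c: "c \<in> M" by blast
  have "\<exists>(\<mu> :: ('a \<Rightarrow> real) measure) f. (\<forall>x\<in>M. integrable \<mu> (f x)) \<and>
        (\<forall>x\<in>M. \<forall>x'\<in>M. D i x x' = L1_norm \<mu> (\<lambda>w. f x w - f x' w))" for i
    using ker[of i] unfolding L1_kernel_def .
  then obtain \<mu> :: "'i \<Rightarrow> ('a \<Rightarrow> real) measure" and f where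
    int: "\<And>i x. x \<in> M \<Longrightarrow> integrable (\<mu> i) (f i x)" and
    D: "\<And>i x x'. x \<in> M \<Longrightarrow> x' \<in> M \<Longrightarrow> D i x x' = L1_norm (\<mu> i) (\<lambda>w. f i x w - f i x' w)"
    by metis
  define F where "F x = (\<lambda>(i, w). f i x w - f i c w)" for x
  have F_meas: "F x \<in> borel_measurable (direct_sum \<mu>)" if "x \<in> M" for x
    using int[OF that] int[OF c] by (intro measurable_direct_sum) (auto simp: F_def)
  have nn: "(\<integral>\<^sup>+q. ennreal \<bar>F x q - F x' q\<bar> \<partial>direct_sum \<mu>) =
      ennreal (\<Sum>i | D i x x' \<noteq> 0. D i x x')" if x: "x \<in> M" "x' \<in> M" for x x'
  proof -
    have "(\<integral>\<^sup>+w. ennreal \<bar>F x (i, w) - F x' (i, w)\<bar> \<partial>\<mu> i) = ennreal (D i x x')" for i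
      using x int by (simp add: D F_def L1_norm_def nn_integral_eq_integral)
    then have "(\<integral>\<^sup>+q. ennreal \<bar>F x q - F x' q\<bar> \<partial>direct_sum \<mu>) =
        (\<integral>\<^sup>+i. ennreal (D i x x') \<partial>count_space UNIV)"
      using F_meas x by (subst nn_integral_direct_sum) auto
    also have "\<dots> = (\<Sum>i | D i x x' \<noteq> 0. ennreal (D i x x'))"
      using fin[OF x] L1_kernel_nonneg[OF ker x]
      by (subst nn_integral_count_space[where f = "\<lambda>i. ennreal (D i x x')"])
        (auto intro!: sum.cong simp: less_le cong: conj_cong)
    also have "\<dots> = ennreal (\<Sum>i | D i x x' \<noteq> 0. D i x x')"
      using L1_kernel_nonneg[OF ker x] by (intro sum_ennreal) auto
    finally show ?thesis .
  qed
  show ?thesis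
  proof (rule L1_kernelI[of M "direct_sum \<mu>" F])
    fix x assume x: "x \<in> M"
    have "(\<integral>\<^sup>+q. ennreal (norm (F x q)) \<partial>direct_sum \<mu>) < \<infinity>"
      using nn[OF x c] by (simp add: F_def split_def)
    then show "integrable (direct_sum \<mu>) (F x)"
      using F_meas[OF x] by (intro integrableI_bounded)
  next
    fix x x' assume x: "x \<in> M" "x' \<in> M"
    show "(\<Sum>i | D i x x' \<noteq> 0. D i x x') = L1_norm (direct_sum \<mu>) (\<lambda>q. F x q - F x' q)"
      unfolding L1_norm_def using F_meas x L1_kernel_nonneg[OF ker x]
      by (subst integral_eq_nn_integral) (auto simp: nn[OF x] sum_nonneg)
  qed
qed

text \<open>A sum over the index type \<open>bool\<close>.\<close>
lemma L1_kernel_add: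
  assumes "L1_kernel M D" "L1_kernel M E"
  shows "L1_kernel M (\<lambda>x x'. D x x' + E x x')"
proof -
  define G where "G b = (if b then D else E)" for b
  have eq: "(\<Sum>b | G b x x' \<noteq> 0. G b x x') = D x x' + E x x'" for x x'
  proof -
    have "(\<Sum>b | G b x x' \<noteq> 0. G b x x') = (\<Sum>b\<in>UNIV. G b x x')"
      by (rule sum.mono_neutral_left) auto
    then show ?thesis by (simp add: UNIV_bool G_def)
  qed
  have "L1_kernel M (\<lambda>x x'. \<Sum>b | G b x x' \<noteq> 0. G b x x')"
    using assms by (intro L1_kernel_sum) (simp_all add: G_def)
  then show ?thesis unfolding eq .
qed

lemma disagreement_sets:
  assumes "simple_function T f" "simple_function T g"
  shows "{w \<in> space T. f w \<noteq> g w} \<in> sets T"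
  using simple_function_compose2[OF assms, of "(\<noteq>)"] by (auto dest: measurable_simple_function)

text \<open>
  Each value \<open>k\<close> contributes the kernel of the sets \<open>{s x = k}\<close>, and a point \<open>w\<close> with
  \<open>s x w \<noteq> s x' w\<close> is counted for exactly two values. There may be uncountably many values in total, but
  two given points of \<open>M\<close> involve only finitely many of them.
\<close>
lemma L1_kernel_disagreement:
  fixes s :: "'a \<Rightarrow> 'w \<Rightarrow> 'k"
  assumes simple: "\<And>x. x \<in> M \<Longrightarrow> simple_function T (s x)"
    and fin: "\<And>x. x \<in> M \<Longrightarrow> emeasure T {w \<in> space T. s x w \<noteq> k0} < \<infinity>"
  shows "L1_kernel M (\<lambda>x x'. 2 * measure T {w \<in> space T. s x w \<noteq> s x' w})"
proof -
  \<comment> \<open>for \<open>k = k0\<close> the complement, which has the same symmetric differences but finite measure\<close>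
  define B where "B k x = {w \<in> space T. (s x w = k) \<noteq> (k = k0)}" for k x
  define E where "E k x x' = measure T {w \<in> space T. (s x w = k) \<noteq> (s x' w = k)}" for k x x'
  have meas [measurable]: "Measurable.pred T (\<lambda>w. s x w = k)" if "x \<in> M" for x k
    using measurable_simple_function[OF simple[OF that]] by measurable
  have fin': "emeasure T {w \<in> space T. s x w \<noteq> s x' w} < \<infinity>"
    "{w \<in> space T. s x w \<noteq> s x' w} \<in> sets T" if x: "x \<in> M" "x' \<in> M" for x x'
  proof -
    show "{w \<in> space T. s x w \<noteq> s x' w} \<in> sets T"
      by (rule disagreement_sets[OF simple simple]) (fact x)+
    have "emeasure T {w \<in> space T. s x w \<noteq> s x' w} \<le>
        emeasure T ({w \<in> space T. s x w \<noteq> k0} \<union> {w \<in> space T. s x' w \<noteq> k0})"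
      using x by (intro emeasure_mono) auto
    also have "\<dots> \<le> emeasure T {w \<in> space T. s x w \<noteq> k0} + emeasure T {w \<in> space T. s x' w \<noteq> k0}"
      using x by (intro emeasure_subadditive) auto
    also have "\<dots> < \<infinity>" using fin[OF x(1)] fin[OF x(2)] by simp
    finally show "emeasure T {w \<in> space T. s x w \<noteq> s x' w} < \<infinity>" .
  qed
  have ker: "L1_kernel M (E k)" for k
  proof (rule L1_kernelI[of M T "\<lambda>x. indicator (B k x)"])
    fix x assume x: "x \<in> M"
    have "emeasure T (B k x) \<le> emeasure T {w \<in> space T. s x w \<noteq> k0}"
      using x by (intro emeasure_mono) (auto simp: B_def)
    then have "emeasure T (B k x) < \<infinity>" using fin[OF x] by (rule le_less_trans)
    moreover have "B k x \<in> sets T" using x unfolding B_def by measurable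
    ultimately show "integrable T (indicator (B k x) :: _ \<Rightarrow> real)"
      by (simp add: integrable_indicator_iff)
  next
    fix x x' assume "x \<in> M" "x' \<in> M"
    have "L1_norm T (\<lambda>w. indicator (B k x) w - indicator (B k x') w) =
        (\<integral>w. indicator {w \<in> space T. (s x w = k) \<noteq> (s x' w = k)} w \<partial>T)"
      unfolding L1_norm_def by (rule Bochner_Integration.integral_cong) (auto simp: B_def indicator_def)
    also have "\<dots> = E k x x'" by (simp add: E_def Int_absorb2 subset_eq)
    finally show "E k x x' = L1_norm T (\<lambda>w. indicator (B k x) w - indicator (B k x') w)" by simp
  qed
  have sub: "{k. E k x x' \<noteq> 0} \<subseteq> s x ` space T \<union> s x' ` space T" for x x'
  proof -
    have "E k x x' = 0" if "k \<notin> s x ` space T \<union> s x' ` space T" for k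
    proof -
      have "{w \<in> space T. (s x w = k) \<noteq> (s x' w = k)} = {}" using that by auto
      then show ?thesis unfolding E_def by (simp only: measure_empty)
    qed
    then show ?thesis by blast
  qed
  have finV: "finite (s x ` space T \<union> s x' ` space T)" if "x \<in> M" "x' \<in> M" for x x'
    using simple that by (auto simp: simple_function_def)
  have "(\<Sum>k | E k x x' \<noteq> 0. E k x x') = 2 * measure T {w \<in> space T. s x w \<noteq> s x' w}"
    if x: "x \<in> M" "x' \<in> M" for x x'
  proof -
    let ?V = "s x ` space T \<union> s x' ` space T"
    define A where "A k = {w \<in> space T. (s x w = k) \<noteq> (s x' w = k)}" for k
    have intA: "integrable T (indicator (A k) :: _ \<Rightarrow> real)" for k
    proof -
      have "emeasure T (A k) \<le> emeasure T {w \<in> space T. s x w \<noteq> s x' w}"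
        using fin'(2)[OF x] by (intro emeasure_mono) (auto simp: A_def)
      then have "emeasure T (A k) < \<infinity>" using fin'(1)[OF x] by (rule le_less_trans)
      moreover have "A k \<in> sets T" using x unfolding A_def by measurable
      ultimately show ?thesis by (simp add: integrable_indicator_iff)
    qed
    have two: "(\<Sum>k\<in>?V. indicator (A k) w) = (2::real) * indicator {w \<in> space T. s x w \<noteq> s x' w} w"
      if w: "w \<in> space T" for w
    proof -
      have "(\<Sum>k\<in>?V. indicator (A k) w) =
          (\<Sum>k\<in>(if s x w = s x' w then {} else {s x w, s x' w}). (1::real))"
        using finV[OF x] w by (intro sum.mono_neutral_cong_right) (auto simp: A_def indicator_def split: if_splits)
      then show ?thesis using w by auto
    qed
    have "(\<Sum>k | E k x x' \<noteq> 0. E k x x') = (\<Sum>k\<in>?V. E k x x')"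
      using finV[OF x] sub by (intro sum.mono_neutral_left) auto
    also have "\<dots> = (\<Sum>k\<in>?V. \<integral>w. indicator (A k) w \<partial>T)"
      by (simp add: E_def A_def Int_absorb2 subset_eq)
    also have "\<dots> = (\<integral>w. (\<Sum>k\<in>?V. indicator (A k) w) \<partial>T)"
      using intA by (intro Bochner_Integration.integral_sum[symmetric])
    also have "\<dots> = (\<integral>w. 2 * indicator {w \<in> space T. s x w \<noteq> s x' w} w \<partial>T)"
      by (rule Bochner_Integration.integral_cong) (simp_all add: two)
    also have "\<dots> = 2 * measure T {w \<in> space T. s x w \<noteq> s x' w}"
      by (simp add: Int_absorb2 subset_eq)
    finally show ?thesis .
  qed
  moreover have "L1_kernel M (\<lambda>x x'. \<Sum>k | E k x x' \<noteq> 0. E k x x')"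
    using finite_subset[OF sub finV] ker by (intro L1_kernel_sum)
  ultimately show ?thesis by (rule iffD1[OF L1_kernel_cong])
qed

text \<open>The disagreement kernel of constant functions on a one-point space.\<close>
lemma L1_kernel_discrete:
  assumes "0 \<le> c"
  shows "L1_kernel M (\<lambda>x x'. c * of_bool (x \<noteq> x'))"
proof -
  let ?P = "count_space (UNIV :: unit set)"
  have "L1_kernel M (\<lambda>x x'. 2 * measure ?P {w \<in> space ?P. x \<noteq> x'})"
    by (rule L1_kernel_disagreement[of M ?P "\<lambda>x _. x"]) (simp_all add: simple_function_def)
  also have "(\<lambda>x x'. 2 * measure ?P {w \<in> space ?P. x \<noteq> x'}) = (\<lambda>x x'. 2 * of_bool (x \<noteq> x'))"
    by (auto simp: fun_eq_iff)
  finally show ?thesis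
    using L1_kernel_scale[of M "\<lambda>x x'. 2 * of_bool (x \<noteq> x')" "c / 2"] assms by simp
qed

lemma simple_function_filter:
  assumes "finite F" "\<And>z. z \<in> F \<Longrightarrow> {w \<in> space T. P z w} \<in> sets T"
  shows "simple_function T (\<lambda>w. {z \<in> F. P z w})"
  using assms
proof (induction F)
  case (insert a F)
  have "simple_function T (P a)"
    unfolding simple_function_def
  proof (intro conjI ballI)
    fix b
    have "P a -` {b} \<inter> space T = (if b then {w \<in> space T. P a w} else space T - {w \<in> space T. P a w})"
      by auto
    then show "P a -` {b} \<inter> space T \<in> sets T" using insert.prems[of a] by auto
  qed simp
  moreover have "simple_function T (\<lambda>w. {z \<in> F. P z w})" using insert by simp
  ultimately have "simple_function T (\<lambda>w. (if P a w then Set.insert a else id) {z \<in> F. P z w})"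
    by (rule simple_function_compose2)
  also have "(\<lambda>w. (if P a w then Set.insert a else id) {z \<in> F. P z w}) =
      (\<lambda>w. {z \<in> insert a F. P z w})"
    by (auto simp: fun_eq_iff)
  finally show ?case .
qed simp

section \<open>Walls on the wreath product\<close>

fun walk :: "('z \<Rightarrow> 'z \<Rightarrow> real) \<Rightarrow> 'z \<Rightarrow> 'z list \<Rightarrow> 'z \<Rightarrow> real" where
  "walk D u [] v = D u v"
| "walk D u (w # ws) v = D u w + walk D w ws v"

text \<open>
  A pair \<open>(w, t)\<close> stands for the cut of the index type into \<open>{u. t < h u w}\<close> and its complement.
\<close>
definition separating :: "'w measure \<Rightarrow> ('z \<Rightarrow> 'w \<Rightarrow> real) \<Rightarrow> 'z \<Rightarrow> 'z \<Rightarrow> ('w \<times> real) set" where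
  "separating \<mu> h u v =
     {q \<in> space (\<mu> \<Otimes>\<^sub>M lborel). (snd q < h u (fst q)) \<noteq> (snd q < h v (fst q))}"

context
  fixes \<mu> :: "'w measure" and h :: "'z \<Rightarrow> 'w \<Rightarrow> real"
  assumes h: "\<And>z. integrable \<mu> (h z)"
begin

lemma h_measurable [measurable]: "h z \<in> borel_measurable \<mu>"
  using h by (rule borel_measurable_integrable)

text \<open>
  For fixed \<open>w\<close> the separating levels \<open>t\<close> form an interval of length \<open>\<bar>h u w - h v w\<bar>\<close>. Integrating these
  lengths over \<open>w\<close> gives the product measure because the second factor is \<open>\<sigma>\<close>-finite.
\<close>
lemma emeasure_separating:
  "emeasure (\<mu> \<Otimes>\<^sub>M lborel) (separating \<mu> h u v) = ennreal (L1_norm \<mu> (\<lambda>w. h u w - h v w))"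
  and separating_sets: "separating \<mu> h u v \<in> sets (\<mu> \<Otimes>\<^sub>M lborel)"
proof -
  show sets: "separating \<mu> h u v \<in> sets (\<mu> \<Otimes>\<^sub>M lborel)"
    unfolding separating_def by measurable
  have "emeasure lborel (Pair w -` separating \<mu> h u v) = ennreal \<bar>h u w - h v w\<bar>"
    if "w \<in> space \<mu>" for w
  proof -
    have "Pair w -` separating \<mu> h u v = {min (h u w) (h v w)..<max (h u w) (h v w)}"
      using that by (auto simp: separating_def space_pair_measure)
    then show ?thesis by (auto simp: min_def max_def abs_real_def)
  qed
  then have "emeasure (\<mu> \<Otimes>\<^sub>M lborel) (separating \<mu> h u v) = (\<integral>\<^sup>+w. ennreal \<bar>h u w - h v w\<bar> \<partial>\<mu>)"
    by (subst lborel.emeasure_pair_measure_alt[OF sets]) (auto intro: nn_integral_cong)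
  also have "\<dots> = ennreal (L1_norm \<mu> (\<lambda>w. h u w - h v w))"
    unfolding L1_norm_def using h by (intro nn_integral_eq_integral) auto
  finally show "emeasure (\<mu> \<Otimes>\<^sub>M lborel) (separating \<mu> h u v) = ennreal (L1_norm \<mu> (\<lambda>w. h u w - h v w))" .
qed

lemma separating_fmeasurable: "separating \<mu> h u v \<in> fmeasurable (\<mu> \<Otimes>\<^sub>M lborel)"
  using separating_sets by (intro fmeasurableI) (auto simp: emeasure_separating)

lemma measure_separating:
  "measure (\<mu> \<Otimes>\<^sub>M lborel) (separating \<mu> h u v) = L1_norm \<mu> (\<lambda>w. h u w - h v w)"
  by (simp add: measure_def emeasure_separating L1_norm_def)

text \<open>A cut that separates \<open>u\<close> from any point of a walk starting at \<open>u\<close> is crossed by one of its steps.\<close>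
lemma measure_separating_walk:
  "measure (\<mu> \<Otimes>\<^sub>M lborel) (\<Union>w\<in>insert v (set ws). separating \<mu> h u w) \<le>
     walk (\<lambda>u v. L1_norm \<mu> (\<lambda>w. h u w - h v w)) u ws v"
proof (induction ws arbitrary: u)
  case Nil
  then show ?case by (simp add: measure_separating)
next
  case (Cons w' ws)
  let ?T = "\<mu> \<Otimes>\<^sub>M lborel" and ?G = "\<lambda>u. \<Union>w\<in>insert v (set ws). separating \<mu> h u w"
  have G: "?G u \<in> fmeasurable ?T" for u
    by (intro fmeasurable.finite_UN) (auto intro: separating_fmeasurable)
  have "measure ?T (\<Union>w\<in>insert v (set (w' # ws)). separating \<mu> h u w) \<le> measure ?T (separating \<mu> h u w' \<union> ?G w')"
  proof (rule measure_mono_fmeasurable)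
    show "(\<Union>w\<in>insert v (set (w' # ws)). separating \<mu> h u w) \<subseteq> separating \<mu> h u w' \<union> ?G w'"
      by (auto simp: separating_def)
    show "separating \<mu> h u w' \<union> ?G w' \<in> fmeasurable ?T"
      by (intro fmeasurable.Un G separating_fmeasurable)
    show "(\<Union>w\<in>insert v (set (w' # ws)). separating \<mu> h u w) \<in> sets ?T"
      by (intro sets.finite_UN separating_sets) auto
  qed
  also have "\<dots> \<le> measure ?T (separating \<mu> h u w') + measure ?T (?G w')"
    by (rule measure_Un_le[OF separating_sets fmeasurableD[OF G]])
  also have "\<dots> \<le> walk (\<lambda>u v. L1_norm \<mu> (\<lambda>w. h u w - h v w)) u (w' # ws) v"
    using Cons.IH[of w'] by (simp add: measure_separating)
  finally show ?case .
qed

end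

text \<open>
  In the proof, \<open>s (f, y)\<close> assigns to a cut the function that agrees with \<open>f\<close> on the side without \<open>p y\<close>
  and is \<open>x0\<close> elsewhere. It takes finitely many values and is constantly \<open>x0\<close> unless the cut separates
  \<open>p y\<close> from the finite support of \<open>f\<close>; so these functions have a disagreement kernel.

  Both estimates are set inclusions. If \<open>p y\<close> is separated neither from \<open>p y'\<close> nor from any \<open>z\<close> with
  \<open>f z \<noteq> g z\<close>, then \<open>s\<close> takes the same value at both points. If \<open>z\<close> with \<open>f z \<noteq> g z\<close> is separated from
  \<open>p y\<close> and \<open>p y\<close> is not separated from \<open>p y'\<close>, then \<open>z\<close> is on the other side for both points and the
  values of \<open>s\<close> differ at \<open>z\<close>.
\<close>
lemma wreath_wall_kernel:
  fixes p :: "'y \<Rightarrow> 'z" and x0 :: 'x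
  assumes "L1_kernel UNIV D"
  obtains W where "L1_kernel (wreath_carrier x0) W"
    and "\<And>f y g y' z. (f, y) \<in> wreath_carrier x0 \<Longrightarrow> (g, y') \<in> wreath_carrier x0 \<Longrightarrow>
      f z \<noteq> g z \<Longrightarrow> D (p y) z \<le> W (f, y) (g, y') + D (p y) (p y')"
    and "\<And>f y g y' ws. (f, y) \<in> wreath_carrier x0 \<Longrightarrow> (g, y') \<in> wreath_carrier x0 \<Longrightarrow>
      {z. f z \<noteq> g z} \<subseteq> set ws \<Longrightarrow> W (f, y) (g, y') \<le> 2 * walk D (p y) ws (p y')"
proof -
  obtain \<mu> :: "('z \<Rightarrow> real) measure" and h where
    h: "\<And>z. integrable \<mu> (h z)" and D: "\<And>u v. D u v = L1_norm \<mu> (\<lambda>w. h u w - h v w)"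
    using assms by (rule L1_kernelE) auto
  let ?T = "\<mu> \<Otimes>\<^sub>M lborel" and ?sep = "separating \<mu> h"
  define s where "s q \<tau> = (\<lambda>z. if z \<in> {z \<in> {z. fst q z \<noteq> x0}. \<tau> \<in> ?sep (p (snd q)) z} then fst q z else x0)"
    for q :: "('z \<Rightarrow> 'x) \<times> 'y" and \<tau>
  define W where "W q q' = 2 * measure ?T {\<tau> \<in> space ?T. s q \<tau> \<noteq> s q' \<tau>}" for q q'
  note fm = separating_fmeasurable[of \<mu> h, OF h]
  have sub: "?sep u v \<subseteq> space ?T" for u v by (auto simp: separating_def)
  have simple: "simple_function ?T (s q)" if q: "q \<in> wreath_carrier x0" for q
  proof -
    have "simple_function ?T (\<lambda>\<tau>. {z \<in> {z. fst q z \<noteq> x0}. \<tau> \<in> ?sep (p (snd q)) z})"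
    proof (rule simple_function_filter)
      show "finite {z. fst q z \<noteq> x0}" using q by (auto simp: wreath_carrier_def)
      show "{\<tau> \<in> space ?T. \<tau> \<in> ?sep (p (snd q)) z} \<in> sets ?T" for z
        using separating_sets[of \<mu> h, OF h] sub by (simp add: Int_absorb1 flip: Int_def)
    qed
    then show ?thesis unfolding s_def by (rule simple_function_compose1)
  qed
  have fin: "emeasure ?T {\<tau> \<in> space ?T. s q \<tau> \<noteq> (\<lambda>_. x0)} < \<infinity>" if q: "q \<in> wreath_carrier x0" for q
  proof -
    let ?G = "\<Union>z\<in>{z. fst q z \<noteq> x0}. ?sep (p (snd q)) z"
    have G: "?G \<in> fmeasurable ?T"
      using q by (intro fmeasurable.finite_UN fm) (auto simp: wreath_carrier_def)
    have "emeasure ?T {\<tau> \<in> space ?T. s q \<tau> \<noteq> (\<lambda>_. x0)} \<le> emeasure ?T ?G"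
      using G by (intro emeasure_mono) (auto simp: s_def fun_eq_iff)
    also have "\<dots> < \<infinity>" using G by (auto simp: fmeasurable_def)
    finally show ?thesis .
  qed
  have differ: "{\<tau> \<in> space ?T. s q \<tau> \<noteq> s q' \<tau>} \<in> sets ?T"
    if "q \<in> wreath_carrier x0" "q' \<in> wreath_carrier x0" for q q'
    by (rule disagreement_sets[OF simple simple]) (fact that)+
  have cover: "{\<tau> \<in> space ?T. s (f, y) \<tau> \<noteq> s (g, y') \<tau>} \<subseteq> (\<Union>w\<in>insert (p y') (set ws). ?sep (p y) w)"
    if ws: "{z. f z \<noteq> g z} \<subseteq> set ws" for f g y y' ws
  proof (rule subsetI, rule ccontr)
    fix \<tau> assume "\<tau> \<in> {\<tau> \<in> space ?T. s (f, y) \<tau> \<noteq> s (g, y') \<tau>}"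
      and not: "\<tau> \<notin> (\<Union>w\<in>insert (p y') (set ws). ?sep (p y) w)"
    then have \<tau>: "\<tau> \<in> space ?T" and ne: "s (f, y) \<tau> \<noteq> s (g, y') \<tau>" by auto
    from not \<tau> have *: "\<tau> \<in> ?sep (p y') z \<longleftrightarrow> \<tau> \<in> ?sep (p y) z" for z
      by (auto simp: separating_def)
    have "s (f, y) \<tau> z = s (g, y') \<tau> z" for z
    proof (cases "f z = g z")
      case True
      then show ?thesis by (simp add: s_def *)
    next
      case False
      then have "\<tau> \<notin> ?sep (p y) z" using not ws by auto
      then show ?thesis by (simp add: s_def *)
    qed
    with ne show False by blast
  qed
  have "L1_kernel (wreath_carrier x0) W"
    unfolding W_def using simple fin by (rule L1_kernel_disagreement)
  moreover have "D (p y) z \<le> W (f, y) (g, y') + D (p y) (p y')"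
    if c: "(f, y) \<in> wreath_carrier x0" "(g, y') \<in> wreath_carrier x0" and z: "f z \<noteq> g z" for f y g y' z
  proof -
    let ?N = "{\<tau> \<in> space ?T. s (f, y) \<tau> \<noteq> s (g, y') \<tau>}"
    have "finite {z. f z \<noteq> g z}"
      using c by (auto simp: wreath_carrier_def intro: finite_support)
    then obtain ws where ws: "set ws = {z. f z \<noteq> g z}" using finite_list by blast
    have "(\<Union>w\<in>insert (p y') (set ws). ?sep (p y) w) \<in> fmeasurable ?T"
      by (intro fmeasurable.finite_UN fm) auto
    then have N: "?N \<in> fmeasurable ?T"
      by (rule fmeasurableI2[OF _ cover differ[OF c]]) (simp add: ws)
    have "?sep (p y) z \<subseteq> ?N \<union> ?sep (p y) (p y')"
    proof
      fix \<tau> assume \<tau>: "\<tau> \<in> ?sep (p y) z"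
      show "\<tau> \<in> ?N \<union> ?sep (p y) (p y')"
      proof (cases "\<tau> \<in> ?sep (p y) (p y')")
        case False
        then have "\<tau> \<in> ?sep (p y') z" using \<tau> by (auto simp: separating_def)
        then have "s (f, y) \<tau> z = f z" "s (g, y') \<tau> z = g z" using \<tau> by (auto simp: s_def)
        then have "s (f, y) \<tau> \<noteq> s (g, y') \<tau>" using z by metis
        then show ?thesis using \<tau> sub by blast
      qed simp
    qed
    then have "measure ?T (?sep (p y) z) \<le> measure ?T (?N \<union> ?sep (p y) (p y'))"
      by (rule measure_mono_fmeasurable[OF _ fmeasurableD[OF fm] fmeasurable.Un[OF N fm]])
    also have "\<dots> \<le> measure ?T ?N + measure ?T (?sep (p y) (p y'))"
      by (rule measure_Un_le[OF fmeasurableD[OF N] fmeasurableD[OF fm]])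
    also have "\<dots> \<le> W (f, y) (g, y') + D (p y) (p y')"
      by (simp add: W_def D measure_separating[OF h])
    finally show ?thesis by (simp add: D measure_separating[OF h])
  qed
  moreover have "W (f, y) (g, y') \<le> 2 * walk D (p y) ws (p y')"
    if c: "(f, y) \<in> wreath_carrier x0" "(g, y') \<in> wreath_carrier x0"
      and ws: "{z. f z \<noteq> g z} \<subseteq> set ws" for f y g y' ws
  proof -
    have "measure ?T {\<tau> \<in> space ?T. s (f, y) \<tau> \<noteq> s (g, y') \<tau>} \<le>
        measure ?T (\<Union>w\<in>insert (p y') (set ws). ?sep (p y) w)"
      by (intro measure_mono_fmeasurable cover ws differ c fmeasurable.finite_UN fm) auto
    also have "\<dots> \<le> walk D (p y) ws (p y')"
      using measure_separating_walk[of \<mu> h, OF h] unfolding D[abs_def] .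
    finally show ?thesis by (simp add: W_def)
  qed
  ultimately show ?thesis by (rule that)
qed

section \<open>Tours\<close>

text \<open>
  Consecutive points of the walk are within \<open>C\<close> of the images of consecutive points of the tour, whence
  \<open>dist z w \<le> 2 * C + a * dist y v + b\<close> for each step.
\<close>
lemma walk_le_tour_length:
  fixes p :: "'y::metric_space \<Rightarrow> 'z::metric_space" and K a b C :: real
  assumes D: "\<And>u v. D u v \<le> K * (dist u v + 1)" and K: "K \<ge> 0"
    and p: "\<And>y y'. dist (p y) (p y') \<le> a * dist y y' + b"
    and C: "C \<ge> 0"
    and "list_all2 (\<lambda>y z. p y \<in> cball z C) ys zs" "dist (p y) z \<le> C"
  shows "walk D z zs (p y') \<le>
    K * a * tour_length y ys y' + (length zs + 1) * (K * (2 * C + b + 1))"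
  using assms(5,6)
proof (induction ys zs arbitrary: y z rule: list_all2_induct)
  case Nil
  have "dist z (p y') \<le> C + (a * dist y y' + b)"
    using dist_triangle[of z "p y'" "p y"] p[of y y'] Nil by (simp add: dist_commute)
  then have "dist z (p y') + 1 \<le> a * dist y y' + (2 * C + b + 1)" using C by simp
  then have "K * (dist z (p y') + 1) \<le> K * (a * dist y y' + (2 * C + b + 1))"
    using K by (rule mult_left_mono)
  then show ?case using D[of z "p y'"] by (simp add: algebra_simps)
next
  case (Cons v ys w zs)
  have "dist z w \<le> C + (a * dist y v + b) + C"
    using dist_triangle[of z w "p y"] dist_triangle[of "p y" w "p v"] p[of y v] Cons.prems Cons.hyps
    by (simp add: dist_commute)
  then have "K * (dist z w + 1) \<le> K * (a * dist y v + (2 * C + b + 1))"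
    using K by (intro mult_left_mono) auto
  then have "D z w \<le> K * a * dist y v + K * (2 * C + b + 1)"
    using D[of z w] by (simp add: algebra_simps)
  moreover have "walk D w zs (p y') \<le>
      K * a * tour_length v ys y' + (length zs + 1) * (K * (2 * C + b + 1))"
    using Cons.IH[of v w] Cons.hyps by (simp add: dist_commute)
  ultimately show ?case by (simp add: algebra_simps)
qed

lemma path_dist_greatest:
  assumes "C_dense C p" "finite I"
    and "\<And>ys zs. distinct zs \<Longrightarrow> set zs = I \<Longrightarrow> list_all2 (\<lambda>y z. p y \<in> cball z C) ys zs \<Longrightarrow>
      t \<le> tour_length y ys y'"
  shows "t \<le> path_dist C p I y y'"
  unfolding path_dist_def
  by (intro cINF_greatest tours_nonempty assms(1,2)) (use assms(3) in \<open>auto simp: tours_def\<close>)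

text \<open>Visit the points of \<open>I\<close> one after the other, returning to \<open>y\<close> each time.\<close>
lemma path_dist_le_star:
  fixes p :: "'y::metric_space \<Rightarrow> 'z::metric_space"
  assumes "finite I" "\<And>z. z \<in> I \<Longrightarrow> \<exists>v. dist (p v) z \<le> C \<and> dist y v \<le> r"
  shows "path_dist C p I y y' \<le> 2 * r * card I + dist y y'"
proof -
  obtain \<phi> where \<phi>: "\<And>z. z \<in> I \<Longrightarrow> dist (p (\<phi> z)) z \<le> C \<and> dist y (\<phi> z) \<le> r"
    using assms(2) by metis
  obtain zs where zs: "set zs = I" "distinct zs" using finite_distinct_list[OF assms(1)] by blast
  have "list_all2 (\<lambda>y z. p y \<in> cball z C) (map \<phi> zs) zs"
    using \<phi> zs(1) by (auto simp: list_all2_map1 dist_commute intro!: list.rel_refl_strong)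
  then have "map \<phi> zs \<in> tours C p I" using zs unfolding tours_def by blast
  then have "path_dist C p I y y' \<le> tour_length y (map \<phi> zs) y'" by (rule path_dist_le)
  also have "tour_length w vs y' \<le> dist w y + 2 * r * length vs + dist y y'"
    if "\<forall>v\<in>set vs. dist y v \<le> r" for w vs
    using that
  proof (induction vs arbitrary: w)
    case Nil
    then show ?case by (simp add: dist_triangle)
  next
    case (Cons v vs)
    have "dist w v \<le> dist w y + dist y v" by (rule dist_triangle)
    moreover have "dist y v \<le> r" using Cons.prems by simp
    ultimately show ?case using Cons.IH[of v] Cons.prems
      by (simp add: algebra_simps dist_commute)
  qed
  note this[of "map \<phi> zs" y]
  also have "length (map \<phi> zs) = card I" using zs distinct_card by fastforce
  finally show ?thesis using \<phi> zs(1) by auto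
qed

lemma card_tour_vertices:
  fixes y y' :: "'y::metric_space"
  assumes "\<And>v w :: 'y. v \<noteq> w \<Longrightarrow> e \<le> dist v w" "e \<ge> 0"
  shows "e * card (set ys - {y}) \<le> tour_length y ys y'"
proof (induction ys arbitrary: y)
  case (Cons v vs)
  show ?case
  proof (cases "v = y")
    case True
    then show ?thesis using Cons.IH[of v] by simp
  next
    case False
    have "card (set (v # vs) - {y}) \<le> card (insert v (set vs - {v}))"
      by (intro card_mono) auto
    also have "insert v (set vs - {v}) = insert v (set vs)" by simp
    also have "card (insert v (set vs)) = 1 + card (set vs - {v})" by (simp add: card.insert_remove)
    finally have "real (card (set (v # vs) - {y})) \<le> 1 + card (set vs - {v})" by linarith
    then have "e * card (set (v # vs) - {y}) \<le> e * (1 + card (set vs - {v}))"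
      using assms(2) by (rule mult_left_mono)
    also have "\<dots> \<le> dist y v + tour_length v vs y'"
      using Cons.IH[of v] assms(1)[of y v] False by (simp add: distrib_left)
    finally show ?thesis by simp
  qed
qed simp

text \<open>
  A tour with \<open>m\<close> distinct vertices serves at most \<open>m * N\<close> points of \<open>Z\<close>, where \<open>N\<close> bounds the
  cardinality of the balls of radius \<open>C\<close>, and its length is at least \<open>e * (m - 1)\<close>, where \<open>e\<close> is a
  lower bound for the distances of distinct points of \<open>Y\<close>.
\<close>
lemma card_le_path_dist:
  fixes p :: "'y::metric_space \<Rightarrow> 'z::metric_space"
  assumes "uniform_discrete (UNIV :: 'y set)" "bounded_geometry C TYPE('z)" "C_dense C p"
  obtains A where "A \<ge> 0"
    "\<And>I y y'. finite I \<Longrightarrow> card I \<le> A * path_dist C p I y y' + A"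
proof -
  obtain e where "e > 0" and e: "\<And>v w :: 'y. dist v w < e \<Longrightarrow> v = w"
    using assms(1) by (auto simp: uniform_discrete_def)
  obtain N :: nat where "N > 0" and N: "\<And>z :: 'z. finite (cball z C)" "\<And>z :: 'z. card (cball z C) \<le> N"
    using assms(2) by (auto simp: bounded_geometry_def)
  define A where "A = max (N / e) N"
  have le: "card I \<le> A * path_dist C p I y y' + A" if "finite I" for I y y'
  proof -
    have "(card I / N - 1) * e \<le> path_dist C p I y y'"
    proof (rule path_dist_greatest[OF assms(3) \<open>finite I\<close>])
      fix ys zs assume zs: "set zs = I" and l: "list_all2 (\<lambda>y z. p y \<in> cball z C) ys zs"
      have "I \<subseteq> (\<Union>v\<in>set ys. cball (p v) C)"
      proof
        fix z assume "z \<in> I"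
        then obtain i where "i < length zs" "z = zs ! i" using zs by (metis in_set_conv_nth)
        then show "z \<in> (\<Union>v\<in>set ys. cball (p v) C)"
          using l by (auto simp: list_all2_conv_all_nth dist_commute intro!: bexI[of _ "ys ! i"])
      qed
      then have "card I \<le> card (\<Union>v\<in>set ys. cball (p v) C)"
        using N(1) by (intro card_mono) auto
      also have "\<dots> \<le> (\<Sum>v\<in>set ys. card (cball (p v) C))" by (rule card_UN_le) simp
      also have "\<dots> \<le> (\<Sum>v\<in>set ys. N)" by (rule sum_mono) (rule N)
      finally have "card I \<le> card (set ys) * N" by simp
      also have "card (set ys) \<le> card (set ys - {y}) + 1"
      proof -
        have "card (set ys) \<le> card ((set ys - {y}) \<union> {y})" by (intro card_mono) auto
        also have "\<dots> \<le> card (set ys - {y}) + card {y}" by (rule card_Un_le)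
        also have "card {y} = 1" by simp
        finally show ?thesis .
      qed
      finally have "card I \<le> (card (set ys - {y}) + 1) * N" by simp
      then have "real (card I) \<le> (card (set ys - {y}) + 1) * N"
        by (metis of_nat_le_iff of_nat_mult of_nat_add of_nat_1)
      then have "card I / N - 1 \<le> card (set ys - {y})" using \<open>N > 0\<close> by (simp add: field_simps)
      then have "(card I / N - 1) * e \<le> e * card (set ys - {y})"
        using \<open>e > 0\<close> by (simp add: mult.commute)
      also have "\<dots> \<le> tour_length y ys y'"
        using e \<open>e > 0\<close> by (intro card_tour_vertices) (auto simp: not_less[symmetric])
      finally show "(card I / N - 1) * e \<le> tour_length y ys y'" .
    qed
    then have "card I \<le> N / e * path_dist C p I y y' + N"
      using \<open>e > 0\<close> \<open>N > 0\<close> by (simp add: field_simps)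
    moreover have "0 \<le> path_dist C p I y y'"
      using path_dist_ge[OF assms(3) \<open>finite I\<close>, of y y'] zero_le_dist[of y y'] by linarith
    then have "N / e * path_dist C p I y y' + N \<le> A * path_dist C p I y y' + A"
      by (intro add_mono mult_right_mono) (auto simp: A_def)
    ultimately show ?thesis by linarith
  qed
  show ?thesis by (rule that[of A]) (use le in \<open>auto simp: A_def\<close>)
qed

lemma wreath_dist_eq:
  "wreath_dist C p (f, y) (g, y') =
     path_dist C p {z. f z \<noteq> g z} y y' + (\<Sum>z | f z \<noteq> g z. dist (f z) (g z))"
  by (simp add: wreath_dist_def Let_def)

lemma card_support_le_wreath_dist:
  fixes p :: "'y::metric_space \<Rightarrow> 'z::metric_space" and x0 :: "'x::metric_space"
  assumes "uniform_discrete (UNIV :: 'x set) \<or>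
         (uniform_discrete (UNIV :: 'y set) \<and> bounded_geometry C TYPE('z))"
    and dense: "C_dense C p"
  obtains A where "A \<ge> 0"
    "\<And>(f :: 'z \<Rightarrow> 'x) y g y'. finite {z. f z \<noteq> g z} \<Longrightarrow>
      card {z. f z \<noteq> g z} \<le> A * wreath_dist C p (f, y) (g, y') + A"
  using assms(1)
proof
  assume "uniform_discrete (UNIV :: 'x set)"
  then obtain e where "e > 0" and e: "\<And>v w :: 'x. dist v w < e \<Longrightarrow> v = w"
    by (auto simp: uniform_discrete_def)
  have "card {z. f z \<noteq> g z} \<le> 1 / e * wreath_dist C p (f, y) (g, y') + 1 / e"
    if fin: "finite {z. f z \<noteq> g z}" for f g :: "'z \<Rightarrow> 'x" and y y'
  proof -
    have "(\<Sum>z | f z \<noteq> g z. e) \<le> (\<Sum>z | f z \<noteq> g z. dist (f z) (g z))"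
      using e by (intro sum_mono) (auto simp: not_less[symmetric])
    also have "\<dots> \<le> wreath_dist C p (f, y) (g, y')"
      using path_dist_ge[OF dense fin, of y y'] zero_le_dist[of y y']
      unfolding wreath_dist_eq by linarith
    finally show ?thesis using \<open>e > 0\<close> by (simp add: field_simps)
  qed
  then show ?thesis using \<open>e > 0\<close> by (intro that[of "1 / e"]) auto
next
  assume "uniform_discrete (UNIV :: 'y set) \<and> bounded_geometry C TYPE('z)"
  then obtain A where A: "A \<ge> 0" "\<And>I y y'. finite I \<Longrightarrow> card I \<le> A * path_dist C p I y y' + A"
    using card_le_path_dist dense by metis
  have "card {z. f z \<noteq> g z} \<le> A * wreath_dist C p (f, y) (g, y') + A"
    if fin: "finite {z. f z \<noteq> g z}" for f g :: "'z \<Rightarrow> 'x" and y y'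
  proof -
    have "A * path_dist C p {z. f z \<noteq> g z} y y' \<le> A * wreath_dist C p (f, y) (g, y')"
      unfolding wreath_dist_eq using A(1) by (intro mult_left_mono) (auto simp: sum_nonneg)
    then show ?thesis using A(2)[OF fin, of y y'] by linarith
  qed
  then show ?thesis using A(1) by (intro that[of A]) auto
qed

section \<open>Compression in terms of kernels\<close>

lemma L1_compression_nonneg: "0 \<le> L1_compression M d"
proof -
  let ?R = "{map_compression M d \<mu> f | (\<mu> :: ('a \<Rightarrow> real) measure) f. coarse_embedding_L1 M d \<mu> f}"
  have "0 \<le> Sup ?R" if "r \<in> ?R" for r
  proof (rule order_trans)
    show "0 \<le> r" using that by (auto simp: map_compression_bounds)
    show "r \<le> Sup ?R"
      using that by (rule cSup_upper) (auto simp: map_compression_bounds intro!: bdd_aboveI[of _ 1])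
  qed
  then show ?thesis by (auto simp: L1_compression_def Let_def)
qed

text \<open>
  A single constant \<open>K\<close> replaces the multiplicative and the additive constants, so that bounds for
  several kernels can be made to share it.
\<close>
definition compression_bounds ::
  "'a set \<Rightarrow> ('a \<Rightarrow> 'a \<Rightarrow> real) \<Rightarrow> real \<Rightarrow> ('a \<Rightarrow> 'a \<Rightarrow> real) \<Rightarrow> real \<Rightarrow> bool" where
  "compression_bounds M d r D K \<longleftrightarrow>
     L1_kernel M D \<and> 1 \<le> K \<and>
     (\<forall>x\<in>M. \<forall>x'\<in>M. 0 \<le> d x x' \<and> d x x' powr r \<le> K * (D x x' + K) \<and> D x x' \<le> K * (d x x' + 1))"

lemma compression_boundsD:
  assumes "compression_bounds M d r D K" "x \<in> M" "x' \<in> M"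
  shows "0 \<le> D x x'" "d x x' powr r \<le> K * (D x x' + K)" "D x x' \<le> K * (d x x' + 1)"
  using assms L1_kernel_nonneg[of M D] by (auto simp: compression_bounds_def)

lemma compression_bounds_mono:
  assumes "compression_bounds M d r D K" "K \<le> L"
  shows "compression_bounds M d r D L"
  unfolding compression_bounds_def
proof (intro conjI ballI)
  show "L1_kernel M D" "1 \<le> L" using assms by (auto simp: compression_bounds_def)
  fix x x' assume x: "x \<in> M" "x' \<in> M"
  note * = compression_boundsD[OF assms(1) x]
  have K: "1 \<le> K" and d: "0 \<le> d x x'" using assms x by (auto simp: compression_bounds_def)
  have "K * (D x x' + K) \<le> L * (D x x' + L)" "K * (d x x' + 1) \<le> L * (d x x' + 1)"
    using K d *(1) assms(2) by (auto intro!: mult_mono)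
  then show "d x x' powr r \<le> L * (D x x' + L)" "D x x' \<le> L * (d x x' + 1)" using * by linarith+
  show "0 \<le> d x x'" by (rule d)
qed

lemma less_L1_compressionE:
  assumes "e < L1_compression M d" "0 \<le> e" and d: "\<And>x x'. x \<in> M \<Longrightarrow> x' \<in> M \<Longrightarrow> 0 \<le> d x x'"
  obtains r D K where "e < r" "r \<le> 1" "compression_bounds M d r D K"
proof -
  let ?R = "{map_compression M d \<mu> f | (\<mu> :: ('a \<Rightarrow> real) measure) f. coarse_embedding_L1 M d \<mu> f}"
  have R: "?R \<noteq> {}" "e < Sup ?R"
    using assms(1,2) by (auto simp: L1_compression_def Let_def split: if_splits)
  have "bdd_above ?R" by (rule bdd_aboveI[of _ 1]) (auto simp: map_compression_bounds)
  then obtain \<mu> :: "('a \<Rightarrow> real) measure" and f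
    where f: "coarse_embedding_L1 M d \<mu> f" "e < map_compression M d \<mu> f"
    using R less_cSup_iff[of ?R e] by auto
  let ?E = "compression_exponents M d \<mu> f"
  have "?E \<noteq> {}" "e < Sup ?E"
    using f(2) assms(2) by (auto simp: map_compression_def split: if_splits)
  moreover have "bdd_above ?E" by (rule bdd_aboveI[of _ 1]) (auto simp: compression_exponents_def)
  ultimately obtain r where r: "r \<in> ?E" "e < r" using less_cSup_iff by blast
  define D where "D x x' = L1_norm \<mu> (\<lambda>w. f x w - f x' w)" for x x'
  have ker: "L1_kernel M D"
    using f(1) by (intro L1_kernelI[of M \<mu> f]) (auto simp: D_def coarse_embedding_L1_def)
  obtain L B where LB: "L > 0" "B > 0"
    "\<And>x x'. x \<in> M \<Longrightarrow> x' \<in> M \<Longrightarrow> 1 / L * d x x' powr r - B \<le> D x x'"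
    "\<And>x x'. x \<in> M \<Longrightarrow> x' \<in> M \<Longrightarrow> D x x' \<le> L * d x x' + B"
    using r(1) unfolding compression_exponents_def D_def by blast
  let ?K = "max 1 (max L B)"
  have "compression_bounds M d r D ?K"
    unfolding compression_bounds_def
  proof (intro conjI ballI)
    fix x x' assume x: "x \<in> M" "x' \<in> M"
    show "0 \<le> d x x'" by (rule d[OF x])
    have "d x x' powr r \<le> L * (D x x' + B)"
      using LB(1) LB(3)[OF x] by (simp add: field_simps)
    also have "\<dots> \<le> ?K * (D x x' + ?K)"
      using LB(1,2) L1_kernel_nonneg[OF ker x] by (intro mult_mono) auto
    finally show "d x x' powr r \<le> ?K * (D x x' + ?K)" .
    have "L * d x x' + B \<le> ?K * d x x' + ?K"
      using d[OF x] by (intro add_mono mult_right_mono) auto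
    then show "D x x' \<le> ?K * (d x x' + 1)" using LB(4)[OF x] by (simp add: distrib_left)
  qed (use ker in auto)
  then show ?thesis using that r by (auto simp: compression_exponents_def)
qed

text \<open>
  The lower control function \<open>t \<mapsto> t powr r / K - K\<close> tends to infinity because \<open>r\<close> is positive; this
  makes the underlying map a coarse embedding.
\<close>
lemma le_L1_compression:
  assumes bounds: "compression_bounds M d r D K" and r: "0 < r" "r \<le> 1"
  shows "r \<le> L1_compression M d"
proof -
  have ker: "L1_kernel M D" and "K > 0" using bounds by (auto simp: compression_bounds_def)
  note lower = compression_boundsD(2)[OF bounds] and upper = compression_boundsD(3)[OF bounds]
  obtain \<mu> :: "('a \<Rightarrow> real) measure" and f where
    int: "\<And>x. x \<in> M \<Longrightarrow> integrable \<mu> (f x)" and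
    D: "\<And>x x'. x \<in> M \<Longrightarrow> x' \<in> M \<Longrightarrow> D x x' = L1_norm \<mu> (\<lambda>w. f x w - f x' w)"
    using ker by (rule L1_kernelE) auto
  have lower': "1 / K * d x x' powr r - K \<le> D x x'" if "x \<in> M" "x' \<in> M" for x x'
    using lower[OF that] \<open>K > 0\<close> by (simp add: field_simps)
  have upper': "D x x' \<le> K * d x x' + K" if "x \<in> M" "x' \<in> M" for x x'
    using upper[OF that] by (simp add: algebra_simps)
  have "coarse_embedding_L1 M d \<mu> f"
    unfolding coarse_embedding_L1_def
  proof (intro conjI ballI exI)
    let ?l = "\<lambda>t. max 0 (1 / K * t powr r - K)" and ?u = "\<lambda>t. K * t + K"
    show "?l \<in> {0..} \<rightarrow> {0..}" by auto
    show "?u \<in> {0..} \<rightarrow> {0..}" using \<open>K > 0\<close> by auto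
    show "mono_on {0..} ?l"
      using \<open>K > 0\<close> r(1)
      by (intro mono_onI max.mono diff_right_mono mult_left_mono powr_mono2) auto
    show "mono_on {0..} ?u" using \<open>K > 0\<close> by (intro mono_onI) auto
    show "filterlim ?l at_top at_top"
    proof (rule filterlim_at_top_mono)
      have "filterlim (\<lambda>t::real. t powr r) at_top at_top" using r(1) by real_asymp
      then have "filterlim (\<lambda>t. 1 / K * t powr r) at_top at_top"
        using \<open>K > 0\<close> by (intro filterlim_tendsto_pos_mult_at_top[OF tendsto_const]) auto
      then show "filterlim (\<lambda>t. - K + 1 / K * t powr r) at_top at_top"
        by (intro filterlim_tendsto_add_at_top[OF tendsto_const])
    qed auto
    fix x x' assume x: "x \<in> M" "x' \<in> M"
    show "?l (d x x') \<le> L1_norm \<mu> (\<lambda>w. f x w - f x' w)"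
      using lower'[OF x] L1_kernel_nonneg[OF ker x] D[OF x] by auto
    show "L1_norm \<mu> (\<lambda>w. f x w - f x' w) \<le> ?u (d x x')"
      using upper'[OF x] D[OF x] by auto
  qed (rule int)
  moreover have "r \<le> map_compression M d \<mu> f"
  proof -
    let ?E = "compression_exponents M d \<mu> f"
    have "r \<in> ?E"
      unfolding compression_exponents_def using lower' upper' D r \<open>K > 0\<close>
      by (intro CollectI conjI exI[of _ K]) auto
    moreover have "bdd_above ?E" by (rule bdd_aboveI[of _ 1]) (auto simp: compression_exponents_def)
    ultimately show ?thesis by (auto simp: map_compression_def intro: cSup_upper)
  qed
  ultimately show ?thesis using map_compression_le_L1_compression order_trans by metis
qed

lemma le_powr_inverse:
  fixes x Q r \<rho> :: real
  assumes "0 \<le> x" "x powr r \<le> Q" "1 \<le> Q" "0 < \<rho>" "\<rho> \<le> r"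
  shows "x \<le> Q powr (1 / \<rho>)"
proof -
  have "x = (x powr r) powr (1 / r)" using assms by (simp add: powr_powr)
  also have "\<dots> \<le> Q powr (1 / r)" using assms by (intro powr_mono2) auto
  also have "\<dots> \<le> Q powr (1 / \<rho>)" using assms by (intro powr_mono) (auto simp: frac_le)
  finally show ?thesis .
qed

text \<open>
  Subadditivity of \<open>t \<mapsto> t powr r\<close>. For two summands \<open>s, u\<close> use \<open>v \<le> v powr r\<close> for the fractions
  \<open>v = s / (s + u)\<close> and \<open>v = u / (s + u)\<close>, which lie between \<open>0\<close> and \<open>1\<close> and add up to \<open>1\<close>.
\<close>
lemma powr_sum_le_sum_powr:
  fixes t :: "'i \<Rightarrow> real"
  assumes "finite I" "\<And>i. i \<in> I \<Longrightarrow> 0 \<le> t i" "0 < r" "r \<le> 1"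
  shows "(\<Sum>i\<in>I. t i) powr r \<le> (\<Sum>i\<in>I. t i powr r)"
  using assms(1,2)
proof (induction I)
  case (insert i I)
  have sub: "(s + u) powr r \<le> s powr r + u powr r" if "0 \<le> s" "0 \<le> u" for s u :: real
  proof (cases "s + u = 0")
    case False
    then have pos: "0 < s + u" using that by linarith
    have "v / (s + u) \<le> (v / (s + u)) powr r" if "0 \<le> v" "v \<le> s + u" for v
      using that pos assms(3,4) powr_mono'[of r 1 "v / (s + u)"] by auto
    from this[of s] this[of u] that have "s / (s + u) + u / (s + u) \<le> (s / (s + u)) powr r + (u / (s + u)) powr r"
      by fastforce
    then have "1 \<le> (s powr r + u powr r) / (s + u) powr r"
      using that pos by (simp add: powr_divide add_divide_distrib[symmetric])
    then show ?thesis using pos by (simp add: le_divide_eq)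
  qed simp
  have "(\<Sum>i\<in>insert i I. t i) powr r \<le> t i powr r + (\<Sum>i\<in>I. t i) powr r"
    using insert.hyps sub[of "t i" "\<Sum>i\<in>I. t i"] insert.prems by (simp add: sum_nonneg)
  then show ?case using insert by fastforce
qed simp

section \<open>Compression of the wreath product\<close>

text \<open>
  The computation of the exponent. With \<open>Q\<close> the value of the kernel up to constants, \<open>P\<close> the path part
  of the distance in the wreath product and \<open>S\<close> the sum over \<open>Z\<close>, the bound on \<open>P\<close> is the length of
  a star-shaped tour; its leading term \<open>Q * Q powr (\<delta> / \<gamma>)\<close> is at most \<open>Q powr (1 / \<rho>)\<close> because
  \<open>\<rho> \<le> \<gamma> / (\<gamma> + \<delta>)\<close>.
\<close>
lemma wreath_growth:
  fixes P S d n \<alpha> \<beta> \<gamma> \<delta> \<rho> M Q :: real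
  assumes Q: "1 \<le> Q" and M: "0 < M" and \<rho>: "0 < \<rho>" "\<rho> \<le> \<alpha>" "\<rho> \<le> \<beta>" "\<rho> * (\<gamma> + \<delta>) \<le> \<gamma>" "\<rho> \<le> 1"
    and \<gamma>: "0 < \<gamma>" and \<delta>: "0 < \<delta>"
    and d: "0 \<le> d" "0 \<le> S" "S powr \<alpha> \<le> Q" "d powr \<beta> \<le> Q" and n: "0 \<le> n" "n \<le> Q"
    and P: "0 \<le> P" "P \<le> 2 * (M * (Q powr (\<delta> / \<gamma>) + 1)) * n + d"
  shows "(P + S) powr \<rho> \<le> (4 * M + 2) * Q"
proof -
  have inv: "1 + \<delta> / \<gamma> \<le> 1 / \<rho>"
    using \<rho>(1,4) \<gamma> by (simp add: field_simps)
  have one: "1 \<le> Q powr (\<delta> / \<gamma>)" using Q \<gamma> \<delta> by (simp add: ge_one_powr_ge_zero)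
  have "2 * (M * (Q powr (\<delta> / \<gamma>) + 1)) * n \<le> 2 * (M * (2 * Q powr (\<delta> / \<gamma>))) * Q"
    using M one n Q by (intro mult_mono mult_left_mono) auto
  also have "\<dots> = 4 * M * Q powr (1 + \<delta> / \<gamma>)" using Q by (simp add: powr_add)
  also have "\<dots> \<le> 4 * M * Q powr (1 / \<rho>)"
    using M Q inv by (intro mult_left_mono powr_mono) auto
  finally have "P + S \<le> (4 * M + 2) * Q powr (1 / \<rho>)"
    using P(2) le_powr_inverse[OF d(1,4) Q \<rho>(1,3)] le_powr_inverse[OF d(2,3) Q \<rho>(1,2)]
    unfolding distrib_right by linarith
  then have "(P + S) powr \<rho> \<le> ((4 * M + 2) * Q powr (1 / \<rho>)) powr \<rho>"
    using P(1) d(2) \<rho>(1) by (intro powr_mono2) auto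
  also have "\<dots> = (4 * M + 2) powr \<rho> * Q"
    using M Q \<rho>(1) by (simp add: powr_mult powr_powr)
  also have "\<dots> \<le> (4 * M + 2) powr 1 * Q"
    using M Q \<rho>(5) by (intro mult_right_mono powr_mono) auto
  finally show ?thesis using M by simp
qed

text \<open>
  The kernel of the introduction, with \<open>c = K + 1\<close>. The linear bound on the number of points where \<open>f\<close>
  and \<open>g\<close> differ pays for the additive constants that each of these points costs in the upper bound.
\<close>
lemma wreath_compression_bounds:
  fixes p :: "'y::metric_space \<Rightarrow> 'z::metric_space" and x0 :: "'x::metric_space"
    and C a b \<delta> \<rho> rx ry rz K A M :: real
  assumes C: "C \<ge> 0" and dense: "C_dense C p" and ab: "a > 0" "b > 0"
    and lip: "\<And>y y'. dist (p y) (p y') \<le> a * dist y y' + b"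
    and \<delta>: "\<delta> > 0" and \<theta>: "lifts_paths_with C p \<theta>" and "M > 0"
    and M: "\<And>r. r \<ge> 0 \<Longrightarrow> \<theta> r \<le> M * (r powr \<delta> + 1)"
    and "A \<ge> 0" and A: "\<And>(f :: 'z \<Rightarrow> 'x) y g y'. finite {z. f z \<noteq> g z} \<Longrightarrow>
        card {z. f z \<noteq> g z} \<le> A * wreath_dist C p (f, y) (g, y') + A"
    and X: "compression_bounds UNIV (dist :: 'x \<Rightarrow> _) rx DX K"
    and Y: "compression_bounds UNIV (dist :: 'y \<Rightarrow> _) ry DY K"
    and Z: "compression_bounds UNIV (dist :: 'z \<Rightarrow> _) rz DZ K"
    and \<rho>: "0 < \<rho>" "\<rho> \<le> 1" "\<rho> \<le> rx" "\<rho> \<le> ry" "\<rho> * (rz + \<delta>) \<le> rz"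
    and rx: "rx \<le> 1" and rz: "0 < rz"
  shows "\<exists>E L. compression_bounds (wreath_carrier x0) (wreath_dist C p) \<rho> E L"
proof -
  let ?W = "wreath_carrier x0 :: (('z \<Rightarrow> 'x) \<times> 'y) set" and ?d = "wreath_dist C p"
  have K: "1 \<le> K" and ker: "L1_kernel UNIV DX" "L1_kernel UNIV DY" "L1_kernel UNIV DZ"
    using X Y Z by (auto simp: compression_bounds_def)
  note DX = compression_boundsD[OF X UNIV_I UNIV_I]
    and DY = compression_boundsD[OF Y UNIV_I UNIV_I]
    and DZ = compression_boundsD[OF Z UNIV_I UNIV_I]
  obtain W where W: "L1_kernel ?W W"
    and W_lower: "\<And>f y g y' z. (f, y) \<in> ?W \<Longrightarrow> (g, y') \<in> ?W \<Longrightarrow>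
      f z \<noteq> g z \<Longrightarrow> DZ (p y) z \<le> W (f, y) (g, y') + DZ (p y) (p y')"
    and W_upper: "\<And>f y g y' ws. (f, y) \<in> ?W \<Longrightarrow> (g, y') \<in> ?W \<Longrightarrow>
      {z. f z \<noteq> g z} \<subseteq> set ws \<Longrightarrow> W (f, y) (g, y') \<le> 2 * walk DZ (p y) ws (p y')"
    by (rule wreath_wall_kernel[OF ker(3), where ?x0.0 = x0 and p = p]) blast

  \<comment> \<open>the constant \<open>K + 1\<close> makes the kernel at least \<open>1\<close> wherever the points differ\<close>
  define DX' where "DX' x x' = DX x x' + (K + 1) * of_bool (x \<noteq> x')" for x x'
  have DX': "L1_kernel UNIV DX'"
    unfolding DX'_def using K by (intro L1_kernel_add ker(1) L1_kernel_discrete) auto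
  have DX'_refl: "DX' x x = 0" for x using L1_kernel_refl[OF DX'] by simp
  have DX'_ge: "dist x x' powr rx / K + 1 \<le> DX' x x'" if "x \<noteq> x'" for x x'
  proof -
    have "dist x x' powr rx / K \<le> DX x x' + K"
      using DX(2)[of x x'] K by (simp add: pos_divide_le_eq mult.commute)
    then show ?thesis using that by (simp add: DX'_def)
  qed
  have DX'_le: "DX' x x' \<le> K * dist x x' + (2 * K + 1)" for x x'
    using DX(3)[of x x'] K by (cases "x = x'") (auto simp: DX'_def algebra_simps)
  \<comment> \<open>the terms with \<open>fst q z = fst q' z\<close> vanish, as \<open>DX' x x = 0\<close>\<close>
  define DL where "DL q q' = (\<Sum>z | fst q z \<noteq> fst q' z. DX' (fst q z) (fst q' z))"
    for q q' :: "('z \<Rightarrow> 'x) \<times> 'y"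
  have fin: "finite {z. fst q z \<noteq> fst q' z}" if "q \<in> ?W" "q' \<in> ?W" for q q'
    using that by (auto simp: wreath_carrier_def intro: finite_support)
  have DL: "L1_kernel ?W DL"
  proof (rule iffD1[OF L1_kernel_cong L1_kernel_sum])
    show "L1_kernel ?W (\<lambda>q q'. DX' (fst q z) (fst q' z))" for z
      by (rule L1_kernel_comp[OF DX']) simp
    have sub: "{z. DX' (fst q z) (fst q' z) \<noteq> 0} \<subseteq> {z. fst q z \<noteq> fst q' z}"
      for q q' :: "('z \<Rightarrow> 'x) \<times> 'y"
      using DX'_refl by auto
    fix q q' assume q: "q \<in> ?W" "q' \<in> ?W"
    show "finite {z. DX' (fst q z) (fst q' z) \<noteq> 0}" using fin[OF q] sub by (rule finite_subset[rotated])
    show "(\<Sum>z | DX' (fst q z) (fst q' z) \<noteq> 0. DX' (fst q z) (fst q' z)) = DL q q'"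
      unfolding DL_def using fin[OF q] sub by (intro sum.mono_neutral_left) auto
  qed

  define E where "E q q' = DY (snd q) (snd q') + DZ (p (snd q)) (p (snd q')) + W q q' + DL q q'" for q q'
  have E: "L1_kernel ?W E"
    unfolding E_def
    by (intro L1_kernel_add W DL) (rule L1_kernel_comp[OF ker(2)] L1_kernel_comp[OF ker(3)], simp)+

  \<comment> \<open>With \<open>n\<close> the number of points where the functions differ, \<open>c1 * d + c2 * n + c3\<close> is the upper
      bound for \<open>E\<close>, and then \<open>n \<le> A * d + A\<close>. The first argument of \<open>max\<close> serves the lower bound.\<close>
  define B where "B = K * (2 * C + b + 1)"
  define c1 where "c1 = 2 * K + 3 * (K * a)"
  define c2 where "c2 = 2 * B + 2 * K + 1"
  define c3 where "c3 = K + K * (b + 1) + 2 * B"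
  define L where "L = max ((4 * M + 2) * K) (max (c1 + c2 * A) (c3 + c2 * A))"
  have pos: "0 \<le> B" "0 \<le> c2" "K \<le> (4 * M + 2) * K"
    using K C ab(2) \<open>M > 0\<close> by (auto simp: B_def c2_def)
  have "(4 * M + 2) * K \<le> L" by (simp add: L_def)
  then have L: "(4 * M + 2) * K \<le> L" "K \<le> L" "1 \<le> L" using K pos(3) by linarith+

  have bounds: "0 \<le> ?d q q' \<and> ?d q q' powr \<rho> \<le> L * (E q q' + L) \<and> E q q' \<le> L * (?d q q' + 1)"
    if q: "q \<in> ?W" "q' \<in> ?W" for q q'
  proof -
    obtain f y g y' where eq: "q = (f, y)" "q' = (g, y')" by fastforce
    let ?I = "{z. f z \<noteq> g z}"
    have I: "finite ?I" using fin[OF q] by (simp add: eq)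
    define P where "P = path_dist C p ?I y y'"
    define S where "S = (\<Sum>z\<in>?I. dist (f z) (g z))"
    define n where "n = real (card ?I)"
    have d: "?d q q' = P + S" by (simp add: eq wreath_dist_eq P_def S_def)
    have "0 \<le> S" by (simp add: S_def sum_nonneg)
    have "dist y y' \<le> P" unfolding P_def by (rule path_dist_ge[OF dense I])
    then have "0 \<le> P" using zero_le_dist order_trans by blast
    have nonneg: "0 \<le> DY y y'" "0 \<le> DZ (p y) (p y')" "0 \<le> W q q'" "0 \<le> DL q q'"
      using DY(1) DZ(1) L1_kernel_nonneg[OF W q]
        L1_kernel_nonneg[OF DL q] by auto
    have E_eq: "E q q' = DY y y' + DZ (p y) (p y') + W q q' + DL q q'" by (simp add: E_def eq)

    have upper: "E q q' \<le> L * (?d q q' + 1)"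
    proof -
      have 1: "DY y y' \<le> K * (P + 1)"
        using DY(3)[of y y'] \<open>dist y y' \<le> P\<close> K mult_left_mono[of "dist y y' + 1" "P + 1" K]
        by linarith
      have "dist (p y) (p y') + 1 \<le> a * P + b + 1"
        using lip[of y y'] \<open>dist y y' \<le> P\<close> ab(1) mult_left_mono[of "dist y y'" P a] by linarith
      then have "K * (dist (p y) (p y') + 1) \<le> K * (a * P + b + 1)"
        using K by (intro mult_left_mono) auto
      then have 2: "DZ (p y) (p y') \<le> K * (a * P + b + 1)"
        using DZ(3)[of "p y" "p y'"] by linarith
      have "(W q q' / 2 - (n + 1) * B) / (K * a) \<le> P"
        unfolding P_def
      proof (rule path_dist_greatest[OF dense I])
        fix ys zs assume zs: "distinct zs" "set zs = ?I"
          and l: "list_all2 (\<lambda>y z. p y \<in> cball z C) ys zs"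
        have "walk DZ (p y) zs (p y') \<le> K * a * tour_length y ys y' + (length zs + 1) * (K * (2 * C + b + 1))"
          using K C by (intro walk_le_tour_length DZ(3) lip l) auto
        moreover have "real (length zs) = n" using zs distinct_card unfolding n_def by metis
        moreover have "W q q' \<le> 2 * walk DZ (p y) zs (p y')"
          using W_upper[of f y g y' zs] q zs by (simp add: eq)
        ultimately have "W q q' / 2 - (n + 1) * B \<le> tour_length y ys y' * (K * a)"
          by (simp add: B_def algebra_simps)
        then show "(W q q' / 2 - (n + 1) * B) / (K * a) \<le> tour_length y ys y'"
          using K ab(1) by (simp add: pos_divide_le_eq)
      qed
      then have 3: "W q q' \<le> 2 * (K * a * P + (n + 1) * B)"
        using K ab(1) by (simp add: pos_divide_le_eq algebra_simps)
      have "DL q q' \<le> (\<Sum>z\<in>?I. K * dist (f z) (g z) + (2 * K + 1))"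
        unfolding DL_def eq fst_conv by (intro sum_mono DX'_le)
      also have "\<dots> = K * S + n * (2 * K + 1)"
        by (simp add: S_def n_def sum.distrib sum_distrib_left)
      finally have 4: "DL q q' \<le> K * S + n * (2 * K + 1)" .
      have "E q q' \<le> K * P + 3 * (K * a) * P + K * S + c2 * n + c3"
        using 1 2 3 4 unfolding E_eq c2_def c3_def by (simp add: algebra_simps)
      also have "\<dots> \<le> c1 * ?d q q' + c2 * n + c3"
        using \<open>0 \<le> P\<close> \<open>0 \<le> S\<close> K ab(1) unfolding c1_def d by (simp add: algebra_simps)
      also have "c2 * n \<le> c2 * (A * ?d q q' + A)"
        using A[OF I, of y y'] pos(2) by (intro mult_left_mono) (auto simp: n_def eq)
      finally have "E q q' \<le> (c1 + c2 * A) * ?d q q' + (c3 + c2 * A)" by (simp add: algebra_simps)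
      also have "\<dots> \<le> L * ?d q q' + L"
        using \<open>0 \<le> P\<close> \<open>0 \<le> S\<close> by (intro add_mono mult_right_mono) (auto simp: d L_def)
      finally show ?thesis by (simp add: algebra_simps)
    qed

    \<comment> \<open>\<open>Q\<close> bounds \<open>n\<close>, \<open>S powr rx\<close>, \<open>dist y y' powr ry\<close> and, for \<open>z \<in> ?I\<close>, \<open>dist (p y) z powr rz\<close>\<close>
    define Q where "Q = K * (E q q' + K)"
    have E0: "0 \<le> E q q'" using nonneg E_eq by linarith
    have "1 * 1 \<le> K * (E q q' + K)" using K E0 by (intro mult_mono) auto
    then have Q: "1 \<le> Q" by (simp add: Q_def)
    have Q_mono: "K * (t + K) \<le> Q" if "t \<le> E q q'" for t
      unfolding Q_def using that K by (intro mult_left_mono) auto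
    have "(\<Sum>z\<in>?I. dist (f z) (g z) powr rx / K + 1) \<le> DL q q'"
      unfolding DL_def eq fst_conv by (intro sum_mono DX'_ge) auto
    then have DL_ge: "(\<Sum>z\<in>?I. dist (f z) (g z) powr rx) / K + n \<le> DL q q'"
      by (simp add: sum.distrib sum_divide_distrib n_def)
    have "(\<Sum>z\<in>?I. dist (f z) (g z) powr rx) \<ge> 0" by (simp add: sum_nonneg)
    then have "n \<le> E q q'" using DL_ge nonneg K E_eq
      by (smt (verit) divide_nonneg_nonneg)
    also have "\<dots> \<le> Q"
      using mult_mono[of 1 K "E q q'" "E q q' + K"] K E0 by (simp add: Q_def)
    finally have n: "n \<le> Q" .
    have S: "S powr rx \<le> Q"
    proof -
      have "S powr rx \<le> (\<Sum>z\<in>?I. dist (f z) (g z) powr rx)"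
        unfolding S_def using I rx \<rho>(1,3) by (intro powr_sum_le_sum_powr) auto
      also have "\<dots> \<le> K * DL q q'"
      proof -
        have "(\<Sum>z\<in>?I. dist (f z) (g z) powr rx) / K \<le> DL q q'"
          using DL_ge unfolding n_def by linarith
        then show ?thesis using K by (simp add: pos_divide_le_eq mult.commute)
      qed
      also have "\<dots> \<le> Q"
        using nonneg K E_eq unfolding Q_def by (intro mult_left_mono) auto
      finally show ?thesis .
    qed
    have dY: "dist y y' powr ry \<le> Q"
      using DY(2)[of y y'] Q_mono[of "DY y y'"] nonneg E_eq by linarith
    have star: "P \<le> 2 * (M * (Q powr (\<delta> / rz) + 1)) * n + dist y y'"
      unfolding P_def n_def
    proof (rule path_dist_le_star[OF I])
      fix z assume z: "z \<in> ?I"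
      have "DZ (p y) z \<le> E q q'" using W_lower[of f y g y' z] q z nonneg E_eq by (simp add: eq)
      then have "dist (p y) z powr rz \<le> Q"
        using DZ(2)[of "p y" z] Q_mono[of "DZ (p y) z"] by linarith
      then have "(dist (p y) z powr rz) powr (\<delta> / rz) \<le> Q powr (\<delta> / rz)"
        using \<delta> rz by (intro powr_mono2) auto
      then have "dist (p y) z powr \<delta> \<le> Q powr (\<delta> / rz)" using rz by (simp add: powr_powr)
      then have "M * (dist (p y) z powr \<delta> + 1) \<le> M * (Q powr (\<delta> / rz) + 1)"
        using \<open>M > 0\<close> by (intro mult_left_mono) auto
      moreover obtain v where "dist (p v) z \<le> C" "dist y v \<le> \<theta> (dist (p y) z)"
        using \<theta> C unfolding lifts_paths_with_def by (metis dist_self)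
      ultimately show "\<exists>v. dist (p v) z \<le> C \<and> dist y v \<le> M * (Q powr (\<delta> / rz) + 1)"
        using M[of "dist (p y) z"] by (intro exI[of _ v]) auto
    qed
    have "?d q q' powr \<rho> \<le> (4 * M + 2) * Q"
      unfolding d
    proof (rule wreath_growth[OF Q \<open>M > 0\<close> \<rho>(1) _ _ \<rho>(5) _ rz \<delta> _ \<open>0 \<le> S\<close> S dY _ n \<open>0 \<le> P\<close> star])
    qed (use \<rho> in \<open>auto simp: n_def\<close>)
    also have "\<dots> = ((4 * M + 2) * K) * (E q q' + K)" by (simp add: Q_def)
    also have "\<dots> \<le> L * (E q q' + L)"
      using K E0 L by (intro mult_mono) auto
    finally show ?thesis using upper d \<open>0 \<le> P\<close> \<open>0 \<le> S\<close> by simp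
  qed
  have "compression_bounds ?W ?d \<rho> E L"
    using E bounds L(3) by (simp add: compression_bounds_def)
  then show ?thesis by blast
qed

theorem theorem5p2:
  fixes p :: "'y::metric_space \<Rightarrow> 'z::metric_space"
    and x0 :: "'x::metric_space"
    and C a b \<delta> \<alpha> \<beta> \<gamma> :: real
  assumes "C \<ge> 0"
    and "C_dense C p"
    and "bornologous p"
    and "coarse_path_lifting C p"
    and "uniform_discrete (UNIV :: 'x set) \<or>
         (uniform_discrete (UNIV :: 'y set) \<and> bounded_geometry C TYPE('z))"
    and "a > 0" and "b > 0"
    and "\<And>y y'. dist (p y) (p y') \<le> a * dist y y' + b"
    and "\<delta> > 0"
    and "polynomial_path_lifting \<delta> C p"
    and "L1_compression (UNIV :: 'x set) dist = \<alpha>"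
    and "L1_compression (UNIV :: 'y set) dist = \<beta>"
    and "L1_compression (UNIV :: 'z set) dist = \<gamma>"
  shows "L1_compression (wreath_carrier x0) (wreath_dist C p) \<ge> min \<alpha> (min \<beta> (\<gamma> / (\<gamma> + \<delta>)))"
proof (rule dense_le)
  fix \<rho> assume "\<rho> < min \<alpha> (min \<beta> (\<gamma> / (\<gamma> + \<delta>)))"
  then have less: "\<rho> < \<alpha>" "\<rho> < \<beta>" "\<rho> < \<gamma> / (\<gamma> + \<delta>)" by auto
  let ?W = "wreath_carrier x0 :: (('z \<Rightarrow> 'x) \<times> 'y) set" and ?d = "wreath_dist C p"
  note dense = \<open>C_dense C p\<close> and lip = assms(8)
  \<comment> \<open>kernels whose exponents exceed \<open>\<rho>\<close> on \<open>X, Y\<close> and \<open>\<sigma>\<close> on \<open>Z\<close> suffice for the exponent \<open>\<rho>\<close>\<close>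
  show "\<rho> \<le> L1_compression ?W ?d"
  proof (cases "\<rho> \<le> 0")
    case True
    then show ?thesis using L1_compression_nonneg order_trans by blast
  next
    case False
    then have "\<rho> > 0" by simp
    have "\<gamma> \<ge> 0" using L1_compression_nonneg assms(13) by metis
    then have "\<rho> * (\<gamma> + \<delta>) < \<gamma>" using less(3) \<open>\<delta> > 0\<close> by (simp add: pos_less_divide_eq)
    then have \<rho>\<gamma>: "\<rho> * \<delta> < \<gamma> * (1 - \<rho>)" by (simp add: algebra_simps)
    moreover have "0 < \<rho> * \<delta>" using \<open>\<rho> > 0\<close> \<open>\<delta> > 0\<close> by simp
    ultimately have "\<rho> < 1" using \<open>\<gamma> \<ge> 0\<close> by (smt (verit) mult_nonneg_nonpos)
    \<comment> \<open>the solution of \<open>\<sigma> / (\<sigma> + \<delta>) = \<rho>\<close>\<close>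
    define \<sigma> where "\<sigma> = \<rho> * \<delta> / (1 - \<rho>)"
    have \<sigma>: "0 \<le> \<sigma>" "\<sigma> < \<gamma>"
      using \<rho>\<gamma> \<open>0 < \<rho> * \<delta>\<close> \<open>\<rho> < 1\<close> by (auto simp: \<sigma>_def pos_divide_less_eq)
    have hx: "\<rho> < L1_compression (UNIV :: 'x set) dist" and hy: "\<rho> < L1_compression (UNIV :: 'y set) dist"
      and hz: "\<sigma> < L1_compression (UNIV :: 'z set) dist"
      using less \<sigma> assms(11-13) by auto
    obtain rx DX KX where rx: "\<rho> < rx" "rx \<le> 1" and KX: "compression_bounds UNIV (dist :: 'x \<Rightarrow> _) rx DX KX"
      by (rule less_L1_compressionE[OF hx _ zero_le_dist]) (use \<open>\<rho> > 0\<close> in auto)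
    obtain ry DY KY where ry: "\<rho> < ry" "ry \<le> 1" and KY: "compression_bounds UNIV (dist :: 'y \<Rightarrow> _) ry DY KY"
      by (rule less_L1_compressionE[OF hy _ zero_le_dist]) (use \<open>\<rho> > 0\<close> in auto)
    obtain rz DZ KZ where \<sigma>_rz: "\<sigma> < rz" and KZ: "compression_bounds UNIV (dist :: 'z \<Rightarrow> _) rz DZ KZ"
      by (rule less_L1_compressionE[OF hz _ zero_le_dist]) (use \<sigma> in auto)
    have "0 < rz" using \<sigma>_rz \<sigma>(1) by linarith
    moreover have "\<rho> * (rz + \<delta>) \<le> rz"
      using \<sigma>_rz \<open>\<rho> < 1\<close> by (simp add: \<sigma>_def pos_divide_less_eq algebra_simps)
    ultimately have rz: "0 < rz" "\<rho> * (rz + \<delta>) \<le> rz" by auto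
    define K where "K = max KX (max KY KZ)"
    have KXYZ: "KX \<le> K" "KY \<le> K" "KZ \<le> K" by (auto simp: K_def)
    note X = compression_bounds_mono[OF KX KXYZ(1)] and Y = compression_bounds_mono[OF KY KXYZ(2)]
      and Z = compression_bounds_mono[OF KZ KXYZ(3)]
    obtain \<theta> M where \<theta>: "lifts_paths_with C p \<theta>" and "M > 0"
      and M: "\<And>r. r \<ge> 0 \<Longrightarrow> \<theta> r \<le> M * (r powr \<delta> + 1)"
      using assms(10) by (auto simp: polynomial_path_lifting_def)
    obtain A where "A \<ge> 0" and A: "\<And>(f :: 'z \<Rightarrow> 'x) y g y'. finite {z. f z \<noteq> g z} \<Longrightarrow>
        card {z. f z \<noteq> g z} \<le> A * ?d (f, y) (g, y') + A"
      using card_support_le_wreath_dist[OF assms(5) dense] by metis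
    have "\<exists>E L. compression_bounds ?W ?d \<rho> E L"
      by (rule wreath_compression_bounds[OF \<open>C \<ge> 0\<close> dense \<open>a > 0\<close> \<open>b > 0\<close> lip \<open>\<delta> > 0\<close>
            \<theta> \<open>M > 0\<close> M \<open>A \<ge> 0\<close> A X Y Z \<open>\<rho> > 0\<close> _ _ _ rz(2) rx(2) rz(1)])
        (use \<open>\<rho> < 1\<close> rx ry in auto)
    then show ?thesis
      using le_L1_compression \<open>\<rho> > 0\<close> \<open>\<rho> < 1\<close> by (metis less_imp_le)
  qed
qed

end
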